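(* The sets $Y_p(m;\nu)$ ($m\in\mathbb N$, $\nu$ a vertex of the double Young graph $\mathcal Y^+$) form a Pascal $(\mathcal Y^+,0)$-array, where the root $0$ is the empty integer partition in $\Gamma$. The corresponding Catalan sequence of sets is $\mathcal C_p(0)\subseteq\mathcal C_p(0+)\subseteq\mathcal C_p(1)\subseteq\mathcal C_p(1+)\subseteq\cdots$: for each $n\in\mathbb N$ the bra-ket decomposition gives bijections $$\mathcal C_p(n)\to\bigsqcup_{\lambda}Y_p(2n;\lambda)\times Y_p(2n;\lambda),\qquad \mathcal C_p(n+)\to\bigsqcup_{\lambda}Y_p(2n+1;\lambda+)\times Y_p(2n+1;\lambda+),$$ the unions being over integer partitions $\lambda$.
   Context: $\mathbb N=\{0,1,2,\dots\}$. $\Gamma$ is the set of integer partitions $\lambda=(\lambda_1\ge\lambda_2\ge\cdots)$ (all but finitely many entries zero), and $\Gamma^+=\{\lambda+:\lambda\in\Gamma\}$ a second disjoint copy. The double Young graph $\mathcal Y^+$ is the simple undirected graph with vertex set $\Gamma\cup\Gamma^+$ and an edge between $\lambda\in\Gamma$ and $\nu+\in\Gamma^+$ exactly when $\lambda=\nu$ or $\lambda-\nu$ has the form $(0,\dots,0,1,0,0,\dots)$. An undirected edge is regarded as two opposite directed edges. For a rooted graph $(G,v_0)$ with vertices $V$, directed edges $E$, and initial/final maps $i,f:E\to V$, a Pascal $(G,v_0)$-array is a family of sets $Y(m;v)$, $m\in\mathbb N$, $v\in V$, with $Y(0;v_0)$ a singleton and $Y(0;v)=\emptyset$ for $v\neq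 v_0$, for which there are injective edge maps $\phi'_e:Y(m-1;i(e))\hookrightarrow Y(m;f(e))$ ($e\in E$, $m\ge1$) such that $Y(m;v)=\bigsqcup_{e:\,f(e)=v}\phi'_e(Y(m-1;i(e)))$ (disjoint union). Let $\underline n=\{1,\dots,n\}$ and $\underline{n'}=\{1',\dots,n'\}$. $\mathcal C_p(n)$ is the set of set partitions of $\underline n\cup\underline{n'}$, and $\mathcal C_p(n+)\subseteq\mathcal C_p(n+1)$ is the set of set partitions of $\underline{n+1}\cup\underline{(n+1)'}$ in which $n+1$ and $(n+1)'$ lie in the same part. ($\mathcal C_p(n)$ is included in $\mathcal C_p(n+)$ by $p\mapsto p\cup\{\{n+1,(n+1)'\}\}$.) A half-partition of $\underline n$ is a set partition of $\underline n$ together with a division of its set of parts into two (possibly empty) classes; the parts in the second class are called propagating components. For $\lambda$ an integer partition of $l$: $Y_p(2n;\lambda)$ is the set of pairs $(\sigma,T)$ with $\sigma$ a half-partition of $\underline n$ with exactly $l$ propagating components and $T$ a standard Young tableau of shape $\lambda$; $Y_p(2n+1;\lambda+)$ is the set of pairs $(\sigma,T)$ with $\sigma$ a half-partition of $\underline{n+1}$ with exactly $l+1$ propagating components, one of which contains $n+1$, and $T$ a standard Young tableau of shape $\lambda$. All other sets $Y_p(m;\nu)$ (even $m$ with $\nu\in\Gamma^+$, odd $m$ with $\nu\in\Gamma$) are empty. Bra-ket decomposition: given $p\in\mathcal C_p(n)$, the parts contained in $\underline n$ are the non-propagating parts, and the non-empty intersections with $\underline n$ of the parts meeting both $\underline n$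 and $\underline{n'}$ are the propagating components, of a half-partition of $\underline n$; similarly for $\underline{n'}$ (identified with $\underline n$). In each of the two half-partitions the $l$ propagating components are ordered by their smallest elements; the parts of $p$ match them up and so define a permutation in $S_l$, and the Robinson–Schensted correspondence turns this into a pair of standard tableaux of the same shape $\lambda$, the first being attached to the first half-partition and the second to the second. For $p\in\mathcal C_p(n+)$ one proceeds in the same way with $\underline{n+1}$, $\underline{(n+1)'}$, the permutation in $S_l$ being that of the $l$ propagating components other than those containing $n+1$ and $(n+1)'$ (which are matched with each other). *)

theory Defs
  imports "HOL-Library.Disjoint_Sets" "Graph_Theory.Digraph"
begin

text \<open>The \<open>k\<close>-th entry (from \<open>1\<close>) of an integer partition is the value of the function at \<open>k - 1\<close>.\<close>

definition int_partitions :: "(nat \<Rightarrow> nat) set" where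
  "int_partitions = {lam. antimono lam \<and> finite {i. lam i \<noteq> 0}}"

definition psize :: "(nat \<Rightarrow> nat) \<Rightarrow> nat" where
  "psize lam = (\<Sum>i | lam i \<noteq> 0. lam i)"

definition empty_partition :: "nat \<Rightarrow> nat" where
  "empty_partition = (\<lambda>_. 0)"

text \<open>\<open>Inl lam\<close> is the vertex \<open>lam\<close> of the first copy, \<open>Inr lam\<close> is \<open>lam+\<close>.\<close>

type_synonym vertex = "(nat \<Rightarrow> nat) + (nat \<Rightarrow> nat)"

definition double_young_edge :: "(nat \<Rightarrow> nat) \<Rightarrow> (nat \<Rightarrow> nat) \<Rightarrow> bool" where
  "double_young_edge lam nu \<longleftrightarrow>
     lam = nu \<or> (\<exists>k. \<forall>i. int (lam i) - int (nu i) = (if i = k then 1 else 0))"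

definition double_young_graph :: "(vertex, vertex \<times> vertex) pre_digraph" where
  "double_young_graph =
    \<lparr> verts = Inl ` int_partitions \<union> Inr ` int_partitions,
      arcs = (\<Union>lam\<in>int_partitions. \<Union>nu\<in>{nu\<in>int_partitions. double_young_edge lam nu}.
                {(Inl lam, Inr nu), (Inr nu, Inl lam)}),
      tail = fst, head = snd \<rparr>"


definition pascal_array ::
    "('v, 'e) pre_digraph \<Rightarrow> 'v \<Rightarrow> (nat \<Rightarrow> 'v \<Rightarrow> 'y set) \<Rightarrow> bool" where
  "pascal_array G v0 Y \<longleftrightarrow>
     wf_digraph G \<and> v0 \<in> verts G \<and>
     is_singleton (Y 0 v0) \<and>
     (\<forall>v\<in>verts G. v \<noteq> v0 \<longrightarrow> Y 0 v = {}) \<and>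
     (\<exists>\<phi> :: nat \<Rightarrow> 'e \<Rightarrow> 'y \<Rightarrow> 'y.
        \<forall>m\<ge>1.
          (\<forall>e\<in>arcs G. inj_on (\<phi> m e) (Y (m - 1) (tail G e)) \<and>
                       \<phi> m e ` Y (m - 1) (tail G e) \<subseteq> Y m (head G e)) \<and>
          (\<forall>v\<in>verts G.
             Y m v = (\<Union>e\<in>{e\<in>arcs G. head G e = v}. \<phi> m e ` Y (m - 1) (tail G e)) \<and>
             disjoint_family_on (\<lambda>e. \<phi> m e ` Y (m - 1) (tail G e)) {e\<in>arcs G. head G e = v}))"


text \<open>A tableau is the list of its rows, from the longest row down.\<close>

type_synonym tableau = "nat list list"

definition tableau_shape :: "tableau \<Rightarrow> nat \<Rightarrow> nat" where
  "tableau_shape T i = (if i < length T then length (T ! i) else 0)"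

definition standard_tableau :: "(nat \<Rightarrow> nat) \<Rightarrow> tableau \<Rightarrow> bool" where
  "standard_tableau lam T \<longleftrightarrow>
     [] \<notin> set T \<and> tableau_shape T = lam \<and>
     distinct (concat T) \<and> set (concat T) = {1..psize lam} \<and>
     (\<forall>r\<in>set T. sorted_wrt (<) r) \<and>
     (\<forall>i j. Suc i < length T \<and> j < length (T ! Suc i) \<longrightarrow> T ! i ! j < T ! Suc i ! j)"

text \<open>Insertion into a row: \<open>x\<close> replaces the first entry exceeding it, which is bumped; if there is
  none, \<open>x\<close> is appended. A bumped entry is inserted into the next row.\<close>

fun row_insert :: "nat \<Rightarrow> nat list \<Rightarrow> nat list \<times> nat option" where
  "row_insert x [] = ([x], None)"
| "row_insert x (y # ys) =
     (if x < y then (x # ys, Some y) else (let (r, b) = row_insert x ys in (y # r, b)))"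

fun tableau_insert :: "nat \<Rightarrow> tableau \<Rightarrow> tableau" where
  "tableau_insert x [] = [[x]]"
| "tableau_insert x (r # rs) =
     (case row_insert x r of
        (r', None) \<Rightarrow> r' # rs
      | (r', Some y) \<Rightarrow> r' # tableau_insert y rs)"

definition new_box_row :: "tableau \<Rightarrow> tableau \<Rightarrow> nat" where
  "new_box_row P P' = (LEAST k. tableau_shape P k \<noteq> tableau_shape P' k)"

definition add_box :: "nat \<Rightarrow> nat \<Rightarrow> tableau \<Rightarrow> tableau" where
  "add_box k i Q = (if k < length Q then Q[k := Q ! k @ [i]] else Q @ [[i]])"

text \<open>Insertion tableau and recording tableau of the word \<open>\<pi> 1, \<dots>, \<pi> l\<close>.\<close>

primrec robinson_schensted :: "(nat \<Rightarrow> nat) \<Rightarrow> nat \<Rightarrow> tableau \<times> tableau" where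
  "robinson_schensted \<pi> 0 = ([], [])"
| "robinson_schensted \<pi> (Suc l) =
     (let (P, Q) = robinson_schensted \<pi> l;
          P' = tableau_insert (\<pi> (Suc l)) P
      in (P', add_box (new_box_row P P') (Suc l) Q))"


text \<open>First component: the non-propagating parts; second component: the propagating components.\<close>

type_synonym half_partition = "nat set set \<times> nat set set"

definition half_partitions :: "nat \<Rightarrow> half_partition set" where
  "half_partitions n = {(N, C). partition_on {1..n} (N \<union> C) \<and> N \<inter> C = {}}"

definition Yp_even :: "nat \<Rightarrow> (nat \<Rightarrow> nat) \<Rightarrow> (half_partition \<times> tableau) set" where
  "Yp_even n lam =
     {\<sigma> \<in> half_partitions n. card (snd \<sigma>) = psize lam} \<times> {T. standard_tableau lam T}"

definition Yp_odd :: "nat \<Rightarrow> (nat \<Rightarrow> nat) \<Rightarrow> (half_partition \<times> tableau) set" where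
  "Yp_odd n lam =
     {\<sigma> \<in> half_partitions (n + 1). card (snd \<sigma>) = psize lam + 1 \<and> (\<exists>A\<in>snd \<sigma>. n + 1 \<in> A)}
       \<times> {T. standard_tableau lam T}"

fun Yp :: "nat \<Rightarrow> vertex \<Rightarrow> (half_partition \<times> tableau) set" where
  "Yp m (Inl lam) = (if even m then Yp_even (m div 2) lam else {})"
| "Yp m (Inr lam) = (if odd m then Yp_odd (m div 2) lam else {})"


text \<open>\<open>Inl i\<close> is the unprimed vertex \<open>i\<close>, \<open>Inr i\<close> is the primed vertex \<open>i'\<close>.\<close>

type_synonym diagram = "(nat + nat) set set"

definition Cp :: "nat \<Rightarrow> diagram set" where
  "Cp n = {p. partition_on (Inl ` {1..n} \<union> Inr ` {1..n}) p}"

definition Cp_plus :: "nat \<Rightarrow> diagram set" where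
  "Cp_plus n = {p \<in> Cp (n + 1). \<exists>c\<in>p. Inl (n + 1) \<in> c \<and> Inr (n + 1) \<in> c}"

definition add_strand :: "nat \<Rightarrow> diagram \<Rightarrow> diagram" where
  "add_strand n p = p \<union> {{Inl (n + 1), Inr (n + 1)}}"

definition propagating_parts :: "diagram \<Rightarrow> diagram" where
  "propagating_parts p = {c \<in> p. c \<inter> range Inl \<noteq> {} \<and> c \<inter> range Inr \<noteq> {}}"

definition left_half :: "diagram \<Rightarrow> half_partition" where
  "left_half p =
     ((\<lambda>c. Inl -` c) ` {c \<in> p. c \<subseteq> range Inl}, (\<lambda>c. Inl -` c) ` propagating_parts p)"

definition right_half :: "diagram \<Rightarrow> half_partition" where
  "right_half p =
     ((\<lambda>c. Inr -` c) ` {c \<in> p. c \<subseteq> range Inr}, (\<lambda>c. Inr -` c) ` propagating_parts p)"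

text \<open>Position (from \<open>1\<close>) of the component \<open>A\<close> when the components in \<open>C\<close> are ordered by their
  smallest elements.\<close>

definition component_position :: "nat set set \<Rightarrow> nat set \<Rightarrow> nat" where
  "component_position C A = card {B \<in> C. Min B \<le> Min A}"

text \<open>For a set \<open>cs\<close> of \<open>l\<close> propagating parts: the permutation of \<open>{1..l}\<close> that sends \<open>i\<close> to \<open>j\<close> when
  the \<open>i\<close>-th unprimed component and the \<open>j\<close>-th primed component lie in the same part.\<close>

definition matching_perm :: "diagram \<Rightarrow> nat \<Rightarrow> nat" where
  "matching_perm cs i =
     (if i \<in> {1..card cs}
      then THE j. \<exists>c\<in>cs. component_position ((\<lambda>c. Inl -` c) ` cs) (Inl -` c) = i \<and>
                         component_position ((\<lambda>c. Inr -` c) ` cs) (Inr -` c) = j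
      else i)"

text \<open>The parts in \<open>cs\<close> are those that contribute to the permutation. The first component of the
  result is the index \<open>\<lambda>\<close> in the disjoint union.\<close>

definition bra_ket_wrt ::
    "diagram \<Rightarrow> diagram \<Rightarrow>
       (nat \<Rightarrow> nat) \<times> ((half_partition \<times> tableau) \<times> (half_partition \<times> tableau))" where
  "bra_ket_wrt cs p =
     (let (P, Q) = robinson_schensted (matching_perm cs) (card cs)
      in (tableau_shape P, ((left_half p, P), (right_half p, Q))))"

definition bra_ket ::
    "diagram \<Rightarrow> (nat \<Rightarrow> nat) \<times> ((half_partition \<times> tableau) \<times> (half_partition \<times> tableau))" where
  "bra_ket p = bra_ket_wrt (propagating_parts p) p"

definition bra_ket_plus ::
    "nat \<Rightarrow> diagram \<Rightarrow>
       (nat \<Rightarrow> nat) \<times> ((half_partition \<times> tableau) \<times> (half_partition \<times> tableau))" where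
  "bra_ket_plus n p = bra_ket_wrt {c \<in> propagating_parts p. Inl (n + 1) \<notin> c} p"

end

theory Submission
  imports Defs "HOL-Combinatorics.Permutations"
begin

text \<open>
  Why the decomposition is a bijection. A diagram is the same thing as its two half-partitions
  together with the bijection between their propagating components that its parts establish. Once
  the components on each side are numbered by their smallest elements, the bijection becomes a
  permutation, and the Robinson--Schensted correspondence trades the permutation for a pair of
  standard tableaux of one shape. Diagrams in \<open>\<C>\<^sub>p(n)\<close> and in \<open>\<C>\<^sub>p(n+)\<close> are treated at once: a
  vertex \<open>x\<close> is marked, the part through \<open>x\<close> is required to contain \<open>x'\<close> if \<open>x\<close> is one of the
  vertices, and the permutation ignores that part. Taking \<open>x = n + 1\<close> among \<open>n\<close> vertices imposes
  nothing and gives \<open>\<C>\<^sub>p(n)\<close>; among \<open>n + 1\<close> vertices it gives \<open>\<C>\<^sub>p(n+)\<close>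
  (\<open>bij_bra_ket_marked\<close>).

  Robinson--Schensted rests on the reversibility of row insertion: from the result of an insertion
  and the shape before it, the tableau and the inserted letter can be recovered, and every tableau
  with a removable box arises so (\<open>tableau_insert_inj\<close>, \<open>tableau_insert_surj\<close>). The recording
  tableau stores the sequence of shapes, because its largest entry sits in the box created last
  (\<open>remove_max_box\<close>, \<open>add_box_inj\<close>).

  Why the sets form a Pascal array. The edge maps exist once each set \<open>Y(m + 1; v)\<close> is in bijection
  with the disjoint union of the sets \<open>Y(m; u)\<close> over the edges from \<open>u\<close> to \<open>v\<close>
  (\<open>pascal_arrayI\<close>). Both kinds of step combine an operation on half-partitions with a branching
  rule for tableaux.

  From level \<open>2n + 1\<close> to \<open>2n + 2\<close>, the component of \<open>n + 1\<close> may become non-propagating, which keeps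
  the tableau, or stay propagating, which adds a new component to those that the tableau counts.
  In the second case the tableau gains a box with the new largest entry; removing the largest entry
  shows that tableaux of shape \<open>\<lambda>\<close> correspond to those of all shapes \<open>\<lambda> - \<box>\<close>
  (\<open>branching_down\<close>).

  From level \<open>2n\<close> to \<open>2n + 1\<close>, the element \<open>n + 1\<close> either forms a propagating component of its own,
  which keeps the tableau, or joins one of the existing \<open>l + 1\<close> propagating components, which the
  tableau then no longer counts. The choice of the component has to be encoded in a tableau with one
  more box: the tableaux of all shapes \<open>\<nu> + \<box>\<close> correspond to pairs of a letter in
  \<open>{1, \<dots>, l + 1}\<close> and a tableau of shape \<open>\<nu>\<close>, by inserting the letter after making room
  for it (\<open>branching_up\<close>). This is row insertion again, so one fact about tableaux carries both
  halves of the theorem.\<close>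

section \<open>Tableaux with distinct entries\<close>

definition entries :: "tableau \<Rightarrow> nat set" where
  "entries T = set (concat T)"

lemma entries_simps [simp]: "entries [] = {}" "entries (r # rs) = set r \<union> entries rs"
  by (simp_all add: entries_def)

definition first_row :: "tableau \<Rightarrow> nat list" where
  "first_row T = (case T of [] \<Rightarrow> [] | r # _ \<Rightarrow> r)"

lemma first_row_simps [simp]: "first_row [] = []" "first_row (r # rs) = r"
  by (simp_all add: first_row_def)

definition above :: "nat list \<Rightarrow> nat list \<Rightarrow> bool" where
  "above r s \<longleftrightarrow> length s \<le> length r \<and> (\<forall>j<length s. r ! j < s ! j)"

text \<open>Compared with standardness, the entries may be any distinct numbers, since the intermediate stages
  of row insertion do not have the entries \<open>1, \<dots>, l\<close>. The recursion on rows follows the path of a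
  bumped letter, which moves down one row at a time.\<close>

fun tableau :: "tableau \<Rightarrow> bool" where
  "tableau [] \<longleftrightarrow> True"
| "tableau (r # rs) \<longleftrightarrow>
     r \<noteq> [] \<and> sorted_wrt (<) r \<and> above r (first_row rs) \<and> set r \<inter> entries rs = {} \<and> tableau rs"

text \<open>Whether the box fits, so that the result is a partition again, is stated separately where it matters.\<close>

definition grow :: "(nat \<Rightarrow> nat) \<Rightarrow> nat \<Rightarrow> nat \<Rightarrow> nat" where
  "grow lam k = lam(k := Suc (lam k))"

lemma shape_Nil [simp]: "tableau_shape [] = (\<lambda>_. 0)"
  by (simp add: tableau_shape_def fun_eq_iff)

lemma shape_Cons [simp]: "tableau_shape (r # rs) = case_nat (length r) (tableau_shape rs)"
  by (auto simp: tableau_shape_def fun_eq_iff split: nat.split)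

lemma grow_case_nat [simp]:
  "grow (case_nat a f) 0 = case_nat (Suc a) f"
  "grow (case_nat a f) (Suc k) = case_nat a (grow f k)"
  by (auto simp: grow_def fun_eq_iff split: nat.split)

lemma case_nat_eq_iff [simp]: "case_nat a f = case_nat b g \<longleftrightarrow> a = b \<and> f = g"
  by (auto simp: fun_eq_iff split: nat.split)

lemma case_nat_split_fun: "lam = case_nat (lam 0) (\<lambda>i. lam (Suc i))"
  by (auto simp: fun_eq_iff split: nat.split)

lemma shape_0: "tableau_shape T 0 = length (first_row T)"
  by (cases T) auto

lemma shape_eq_0_iff: "tableau T \<Longrightarrow> tableau_shape T = (\<lambda>_. 0) \<longleftrightarrow> T = []"
  by (cases T) (auto dest: fun_cong[where x = 0])

lemma antimono_case_nat: "antimono (case_nat a f) \<longleftrightarrow> f 0 \<le> a \<and> antimono (f :: nat \<Rightarrow> nat)"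
  unfolding antimono_iff_le_Suc by (auto split: nat.split)

lemma antimono_shape: "tableau T \<Longrightarrow> antimono (tableau_shape T)"
  by (induction T) (auto simp: antimono_case_nat shape_0 above_def intro: antimonoI)

lemma grow_eq_iff [simp]: "grow lam k = grow lam j \<longleftrightarrow> k = j"
  by (auto simp: grow_def fun_eq_iff)

section \<open>Row insertion and its reversal\<close>

lemma row_insert_append:
  "\<forall>y\<in>set r. \<not> x < y \<Longrightarrow> row_insert x r = (r @ [x], None)"
  by (induction r) auto

lemma row_insert_bump:
  "\<lbrakk>j < length r; \<forall>i<j. \<not> x < r ! i; x < r ! j\<rbrakk> \<Longrightarrow> row_insert x r = (r[j := x], Some (r ! j))"
proof (induction r arbitrary: j)
  case (Cons y ys)
  show ?case
  proof (cases j)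
    case 0
    then show ?thesis using Cons.prems by simp
  next
    case (Suc i)
    have "row_insert x ys = (ys[i := x], Some (ys ! i))"
      using Cons.prems Suc by (intro Cons.IH) auto
    moreover have "\<not> x < y" using Cons.prems(2) Suc by auto
    ultimately show ?thesis by (simp add: Suc)
  qed
qed simp

lemma row_insert_cases:
  obtains (append) "\<And>i. i < length r \<Longrightarrow> r ! i \<le> x" "row_insert x r = (r @ [x], None)"
  | (bump) j where "j < length r" "\<And>i. i < j \<Longrightarrow> r ! i \<le> x" "x < r ! j"
      "row_insert x r = (r[j := x], Some (r ! j))"
proof (cases "\<exists>j<length r. x < r ! j")
  case True
  define j where "j = (LEAST j. j < length r \<and> x < r ! j)"
  have j: "j < length r \<and> x < r ! j"
    unfolding j_def by (rule LeastI_ex) (use True in blast)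
  have "\<forall>i<j. \<not> x < r ! i"
    using j not_less_Least[of _ "\<lambda>j. j < length r \<and> x < r ! j"] unfolding j_def
    by (metis (no_types, lifting) j_def order.strict_trans)
  with j row_insert_bump[of j r x] show ?thesis by (intro bump[of j]) (auto simp: not_less)
next
  case False
  then have "\<forall>y\<in>set r. \<not> x < y" by (auto simp: in_set_conv_nth)
  with row_insert_append show ?thesis by (intro append) (auto simp: not_less)
qed

lemma set_list_update_nth: "j < length r \<Longrightarrow> insert (r ! j) (set (r[j := x])) = insert x (set r)"
  by (induction r arbitrary: j) (auto split: nat.split simp: insert_commute)

lemma entries_tableau_insert: "entries (tableau_insert x T) = insert x (entries T)"
proof (induction T arbitrary: x)
  case (Cons r rs)
  show ?case
  proof (cases r x rule: row_insert_cases)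
    case (bump j)
    then show ?thesis using set_list_update_nth[of j r x] Cons[of "r ! j"] by auto
  qed auto
qed simp

text \<open>Bumping preserves the length of a row, so only the row where the insertion ends becomes longer.\<close>

lemma shape_tableau_insert:
  "\<exists>k. tableau_shape (tableau_insert x T) = grow (tableau_shape T) k"
proof (induction T arbitrary: x)
  case Nil
  show ?case by (intro exI[of _ 0]) (auto simp: grow_def fun_eq_iff split: nat.split)
next
  case (Cons r rs)
  show ?case
  proof (cases r x rule: row_insert_cases)
    case append
    then show ?thesis by (intro exI[of _ 0]) simp
  next
    case (bump j)
    from Cons[of "r ! j"] obtain k
      where "tableau_shape (tableau_insert (r ! j) rs) = grow (tableau_shape rs) k" ..
    with bump show ?thesis by (intro exI[of _ "Suc k"]) simp
  qed
qed

lemma sorted_list_update: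
  assumes "sorted_wrt (<) (r :: nat list)" "\<And>i. i < j \<Longrightarrow> r ! i < x"
    "\<And>i. j < i \<Longrightarrow> i < length r \<Longrightarrow> x < r ! i"
  shows "sorted_wrt (<) (r[j := x])"
  unfolding sorted_wrt_iff_nth_less
proof (intro allI impI)
  fix a b assume ab: "a < b" "b < length (r[j := x])"
  then have "r ! a < r ! b" "a < length r" using sorted_wrt_nth_less[OF assms(1)] by simp_all
  then show "r[j := x] ! a < r[j := x] ! b" using ab assms(2)[of a] assms(3)[of b]
    by (cases "a = j"; cases "b = j") (auto simp: nth_list_update)
qed

lemma sorted_append1:
  "sorted_wrt (<) (r :: nat list) \<Longrightarrow> \<forall>y\<in>set r. y < x \<Longrightarrow> sorted_wrt (<) (r @ [x])"
  by (simp add: sorted_wrt_append)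

lemma first_row_tableau_insert:
  "first_row (tableau_insert x T) = fst (row_insert x (first_row T))"
  by (cases T) (auto split: prod.split option.split)

text \<open>The bumped letter \<open>r ! j\<close> lands in the next row in some column \<open>i \<le> j\<close>, because the entry below it
  is larger already. To the left of column \<open>j\<close> and in it, the entries of the upper row are smaller than
  the bumped letter, so columns still increase.\<close>

lemma above_bump:
  assumes r: "sorted_wrt (<) r" "j < length r" "x < r ! j" and s: "above r s"
  shows "above (r[j := x]) (fst (row_insert (r ! j) s))"
proof (cases s "r ! j" rule: row_insert_cases)
  case append
  have len: "length s \<le> j"
    using append(1)[of j] s r by (auto simp: above_def not_le[symmetric])
  have "r[j := x] ! i < (s @ [r ! j]) ! i" if "i < Suc (length s)" for i
  proof (cases "i = length s")
    case True
    then show ?thesis using r len sorted_wrt_nth_less[OF r(1), of i j] 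
      by (cases "i = j") (auto simp: nth_append)
  next
    case False
    then show ?thesis using that s len by (auto simp: nth_append above_def)
  qed
  then show ?thesis using append r len by (simp add: above_def)
next
  case (bump i)
  have ij: "i \<le> j"
  proof (rule ccontr)
    assume "\<not> i \<le> j"
    then show False using bump(1) bump(2)[of j] s unfolding above_def
      by (metis leD less_trans not_le_imp_less)
  qed
  have "r[j := x] ! t < s[i := r ! j] ! t" if "t < length s" for t
  proof (cases "t = i")
    case True
    then show ?thesis using r ij sorted_wrt_nth_less[OF r(1), of i j] that
      by (cases "i = j") auto
  next
    case False
    moreover have "r ! t < s ! t" using s that by (auto simp: above_def)
    ultimately show ?thesis using r that s by (auto simp: nth_list_update above_def)
  qed
  then show ?thesis using bump s by (simp add: above_def)
qed

lemma tableau_tableau_insert: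
  "tableau T \<Longrightarrow> x \<notin> entries T \<Longrightarrow> tableau (tableau_insert x T)"
proof (induction T arbitrary: x)
  case (Cons r rs)
  have r: "sorted_wrt (<) r" "above r (first_row rs)" "set r \<inter> entries rs = {}" "tableau rs"
    and x: "x \<notin> set r" "x \<notin> entries rs"
    using Cons.prems by auto
  show ?case
  proof (cases r x rule: row_insert_cases)
    case append
    have "\<forall>y\<in>set r. y < x"
      using append(1) x by (metis in_set_conv_nth nat_less_le)
    then show ?thesis using r x append(2) by (auto simp: sorted_append1 above_def nth_append)
  next
    case (bump j)
    have y: "r ! j \<in> set r" using bump by simp
    have sorted: "sorted_wrt (<) (r[j := x])"
    proof (rule sorted_list_update[OF r(1)])
      show "r ! i < x" if "i < j" for i
      proof -
        have "r ! i \<in> set r" using that bump(1) by simp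
        then show ?thesis using bump(2)[OF that] x by (metis nat_less_le)
      qed
      show "x < r ! i" if "j < i" "i < length r" for i
        using sorted_wrt_nth_less[OF r(1) that] bump(3) by simp
    qed
    have "distinct r" using r(1) by (simp add: strict_sorted_iff)
    then have new: "set (r[j := x]) = insert x (set r - {r ! j})"
      using bump(1) by (simp add: set_update_distinct)
    have "above (r[j := x]) (first_row (tableau_insert (r ! j) rs))"
      using above_bump[OF r(1) bump(1,3) r(2)] by (simp add: first_row_tableau_insert)
    moreover have "tableau (tableau_insert (r ! j) rs)"
      using r y by (intro Cons.IH) auto
    moreover have "set (r[j := x]) \<inter> entries (tableau_insert (r ! j) rs) = {}"
      unfolding new entries_tableau_insert using r x bump(3) by auto
    ultimately show ?thesis using bump sorted Cons.prems by auto
  qed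
qed (simp add: above_def)

text \<open>The bumping position can be read off from the outcome: it is the last column whose new entry is
  smaller than the bumped letter.\<close>

lemma bump_inj:
  fixes r r2 :: "nat list"
  assumes "r[j := x] = r2[j2 := x2]" "r ! j = r2 ! j2"
    "sorted_wrt (<) r" "j < length r" "x < r ! j"
    "sorted_wrt (<) r2" "j2 < length r2" "x2 < r2 ! j2"
  shows "x = x2 \<and> r = r2"
proof -
  have aux: "\<not> i < j" 
    if "r[j := x] = s[i := y]" "r ! j = s ! i" "j < length r" "x < r ! j"
      "sorted_wrt (<) s" "i < length s" for r s :: "nat list" and i j x y
  proof
    assume "i < j"
    then have "s ! j = x" using that by (metis length_list_update nth_list_update_eq nth_list_update_neq order.irrefl)
    moreover have "s ! i < s ! j"
      using that \<open>i < j\<close> by (intro sorted_wrt_nth_less) (auto dest: arg_cong[where f = length])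
    ultimately show False using that by simp
  qed
  have "j = j2" using aux[of r j x r2 j2 x2] aux[of r2 j2 x2 r j x] assms by (metis nat_neq_iff)
  with assms show ?thesis
    by (metis length_list_update list_update_id list_update_overwrite nth_list_update_eq)
qed

text \<open>Equal shapes before the insertion force both insertions to end in the same row, so they can be undone
  in parallel: the parts below the first row determine the bumped letter, which by \<open>bump_inj\<close>
  determines the first row and the inserted letter.\<close>

lemma tableau_insert_inj:
  "\<lbrakk>tableau P; tableau P2; tableau_shape P = tableau_shape P2;
    tableau_insert x P = tableau_insert x2 P2\<rbrakk> \<Longrightarrow> x = x2 \<and> P = P2"
proof (induction P arbitrary: P2 x x2)
  case Nil
  then have "P2 = []" by (metis shape_Nil shape_eq_0_iff)
  with Nil show ?case by simp
next
  case (Cons r rs)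
  then have "P2 \<noteq> []" by (metis list.distinct(1) shape_Nil shape_eq_0_iff)
  then obtain r2 rs2 where P2: "P2 = r2 # rs2" by (cases P2) auto
  have len: "length r = length r2" and shape: "tableau_shape rs = tableau_shape rs2"
    using Cons.prems(3) by (auto simp: P2)
  have tab: "sorted_wrt (<) r" "tableau rs" "sorted_wrt (<) r2" "tableau rs2"
    using Cons.prems(1,2) by (auto simp: P2)
  note eq = Cons.prems(4)
  show ?case
  proof (cases r x rule: row_insert_cases)
    case 1: append
    show ?thesis
    proof (cases r2 x2 rule: row_insert_cases)
      case append
      then show ?thesis using 1 eq P2 by simp
    next
      case (bump j)
      then show ?thesis using 1 eq P2 len by (auto dest: arg_cong[where f = length])
    qed
  next
    case 1: (bump j)
    show ?thesis
    proof (cases r2 x2 rule: row_insert_cases)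
      case append
      then show ?thesis using 1 eq P2 len by (auto dest: arg_cong[where f = length])
    next
      case (bump i)
      then have "r[j := x] = r2[i := x2]" 
        "tableau_insert (r ! j) rs = tableau_insert (r2 ! i) rs2"
        using 1 eq P2 by auto
      with Cons.IH[OF tab(2,4) shape this(2)] bump_inj[of r j x r2 i x2] 1 bump tab P2
      show ?thesis by auto
    qed
  qed
qed

text \<open>Reverse bumping: \<open>y\<close> returns from the row below, where it had bumped its way into \<open>s\<close>, and expels the
  largest entry smaller than itself. Such an entry exists, since the entry above the landing column of
  \<open>y\<close> is smaller than \<open>y\<close>.\<close>

lemma row_uninsert:
  assumes r: "sorted_wrt (<) r" and above: "above r (fst (row_insert y s))"
    and s: "sorted_wrt (<) s" "y \<notin> set s" and y: "y \<notin> set r"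
  obtains x r0 where "sorted_wrt (<) r0" "row_insert x r0 = (r, Some y)" "above r0 s"
    "x \<in> set r" "set r0 = insert y (set r - {x})" "length r0 = length r"
proof -
  \<comment> \<open>\<open>i\<close> is the column in which \<open>y\<close> had landed in the row below\<close>
  obtain i where i: "i < length r" "r ! i < y" "i \<le> length s" "length s \<le> length r"
    "\<And>t. t < length s \<Longrightarrow> r ! t < s ! t"
    "\<And>t. i \<le> t \<Longrightarrow> t < length s \<Longrightarrow> y < s ! t"
  proof (cases s y rule: row_insert_cases)
    case append
    then show ?thesis using above
      by (intro that[of "length s"]) 
        (auto simp: above_def nth_append less_Suc_eq all_conj_distrib split: if_splits)
  next
    case (bump i)
    then have ab: "length s \<le> length r" "\<And>t. t < length s \<Longrightarrow> r ! t < s[i := y] ! t"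
      using above by (auto simp: above_def)
    have i: "r ! i < y" using ab(2)[of i] bump(1) by simp
    show ?thesis
    proof (rule that[of i])
      show "r ! t < s ! t" if "t < length s" for t
        using ab(2)[OF that] i bump by (cases "t = i") auto
      show "y < s ! t" if "i \<le> t" "t < length s" for t
        using sorted_wrt_nth_less[OF s(1), of i t] that bump(3) by (cases "t = i") auto
    qed (use ab bump i in auto)
  qed
  \<comment> \<open>the column of the entry that \<open>y\<close> expels\<close>
  define j where "j = Max {t. t < length r \<and> r ! t < y}"
  have fin: "finite {t. t < length r \<and> r ! t < y}" by simp
  have j: "j < length r" "r ! j < y" 
    using Max_in[OF fin] i(1,2) unfolding j_def by blast+
  have max: "r ! t > y" if "j < t" "t < length r" for t
  proof -
    have "\<not> r ! t < y" using Max_ge[OF fin, of t] that unfolding j_def by fastforce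
    moreover have "r ! t \<in> set r" using that by simp
    ultimately show ?thesis using y by (metis linorder_neqE_nat)
  qed
  have ij: "i \<le> j" using Max_ge[OF fin, of i] i unfolding j_def by auto
  have before: "r ! t < r ! j" if "t < j" for t using sorted_wrt_nth_less[OF r that j(1)] .
  have dist: "distinct r" using r by (simp add: strict_sorted_iff)
  show ?thesis
  proof (rule that[of "r[j := y]" "r ! j"])
    show "sorted_wrt (<) (r[j := y])"
      by (rule sorted_list_update[OF r]) (use before j max in \<open>auto intro: less_trans\<close>)
    show "row_insert (r ! j) (r[j := y]) = (r, Some y)"
      using row_insert_bump[of j "r[j := y]" "r ! j"] j before by (auto simp: not_less less_imp_le)
    show "above (r[j := y]) s"
      unfolding above_def
    proof (intro conjI allI impI)
      show "r[j := y] ! t < s ! t" if "t < length s" for t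
        using i(5,6)[of t] that ij j(1) by (cases "t = j") auto
    qed (use i in simp)
    show "set (r[j := y]) = insert y (set r - {r ! j})"
      using j dist by (simp add: set_update_distinct)
  qed (use j in auto)
qed

text \<open>The removable box in row \<open>k\<close> is deleted and its entry is pushed up by reverse bumping through the
  rows above.\<close>

lemma tableau_insert_surj:
  "\<lbrakk>tableau T; antimono lam; tableau_shape T = grow lam k\<rbrakk> \<Longrightarrow>
     \<exists>P x. tableau P \<and> tableau_shape P = lam \<and> x \<notin> entries P \<and> tableau_insert x P = T"
proof (induction T arbitrary: lam k)
  case Nil
  then show ?case by (auto simp: grow_def fun_eq_iff split: if_splits)
next
  case (Cons r rs)
  define nu where "nu = (\<lambda>i. lam (Suc i))"
  have lam: "lam = case_nat (lam 0) nu" unfolding nu_def by (rule case_nat_split_fun)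
  have nu: "antimono nu" "nu 0 \<le> lam 0"
    using Cons.prems(2) antimono_case_nat[of "lam 0" nu] unfolding lam[symmetric] by simp_all
  have r: "r \<noteq> []" "sorted_wrt (<) r" "above r (first_row rs)" "set r \<inter> entries rs = {}" "tableau rs"
    using Cons.prems(1) by auto
  have eq: "case_nat (length r) (tableau_shape rs) = grow (case_nat (lam 0) nu) k"
    using Cons.prems(3) unfolding lam[symmetric] by simp
  show ?case
  proof (cases k)
    case 0
    then have shape: "length r = Suc (lam 0)" "tableau_shape rs = nu"
      using eq by simp_all
    obtain r0 x where r0: "r = r0 @ [x]" using r(1) by (metis rev_exhaust)
    then have x: "\<forall>y\<in>set r0. y < x" "sorted_wrt (<) r0" "x \<notin> entries rs" "lam 0 = length r0"
      using r(2,4) shape(1) by (auto simp: sorted_wrt_append)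
    show ?thesis
    proof (cases "r0 = []")
      case True
      then have nu0: "nu = (\<lambda>_. 0)"
        using nu x by (auto simp: fun_eq_iff) (metis antimonoD le0 le_zero_eq)
      with shape r(5) nu0 have "rs = []" by (simp add: shape_eq_0_iff)
      then show ?thesis using True x nu0 lam r0
        by (intro exI[of _ "[]"] exI[of _ x]) (auto simp: fun_eq_iff split: nat.split)
    next
      case False
      have "length (first_row rs) \<le> length r0" using nu(2) shape(2) x(4) by (metis shape_0)
      then have "above r0 (first_row rs)" using r(3) by (auto simp: above_def r0 nth_append split: if_splits)
      then have "tableau (r0 # rs)" using r x False r0 by auto
      moreover have "tableau_shape (r0 # rs) = lam" using shape x by (subst lam) simp
      moreover have "x \<notin> entries (r0 # rs)" using x by auto
      moreover have "row_insert x r0 = (r, None)" unfolding r0 using x(1) by (intro row_insert_append) auto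
      ultimately show ?thesis by (intro exI[of _ "r0 # rs"] exI[of _ x]) simp
    qed
  next
    case (Suc k')
    then have shape: "length r = lam 0" "tableau_shape rs = grow nu k'"
      using eq by simp_all
    from Cons.IH[OF r(5) nu(1) shape(2)] obtain P y
      where P: "tableau P" "tableau_shape P = nu" "y \<notin> entries P" "tableau_insert y P = rs" by blast
    have rs: "entries rs = insert y (entries P)" using entries_tableau_insert[of y P] P(4) by simp
    have fr: "sorted_wrt (<) (first_row P)" "y \<notin> set (first_row P)" "above r (fst (row_insert y (first_row P)))" "y \<notin> set r"
    proof -
      show "sorted_wrt (<) (first_row P)" "y \<notin> set (first_row P)" using P(1,3) by (cases P; simp)+
      show "above r (fst (row_insert y (first_row P)))"
        using r(3) P(4) first_row_tableau_insert[of y P] by simp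
      show "y \<notin> set r" using r(4) rs by auto
    qed
    from row_uninsert[OF r(2) fr(3) fr(1,2,4)] obtain x r0
      where r0: "sorted_wrt (<) r0" "row_insert x r0 = (r, Some y)" "above r0 (first_row P)"
        "x \<in> set r" "set r0 = insert y (set r - {x})" "length r0 = length r" by blast
    have "tableau (r0 # P)" using r0 P r rs by auto
    moreover have "tableau_shape (r0 # P) = lam" using r0 P shape by (subst lam) simp
    moreover have "x \<notin> entries (r0 # P)" using r0 r rs fr(4) by auto
    moreover have "tableau_insert x (r0 # P) = r # rs" using r0 P by simp
    ultimately show ?thesis by blast
  qed
qed

section \<open>Boxes holding the largest entry\<close>

lemma add_box_simps [simp]:
  "add_box k m [] = [[m]]"
  "add_box 0 m (r # rs) = (r @ [m]) # rs"
  "add_box (Suc k) m (r # rs) = r # add_box k m rs"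
  by (simp_all add: add_box_def)

lemma entries_add_box: "entries (add_box k m Q) = insert m (entries Q)"
proof (induction Q arbitrary: k)
  case (Cons r rs)
  then show ?case by (cases k) auto
qed simp

lemma shape_add_box: "k \<le> length Q \<Longrightarrow> tableau_shape (add_box k m Q) = grow (tableau_shape Q) k"
proof (induction Q arbitrary: k)
  case Nil
  then show ?case by (auto simp: grow_def fun_eq_iff split: nat.split)
next
  case (Cons r rs)
  then show ?case by (cases k) auto
qed

lemma first_row_add_box:
  "first_row (add_box k m Q) = (if k = 0 \<or> Q = [] then first_row Q @ [m] else first_row Q)"
  by (cases Q; cases k) auto

text \<open>A box that keeps the shape a partition lies in an existing row or starts the next one.\<close>

lemma grow_row_le_length:
  assumes "antimono (grow (tableau_shape Q) k)"
  shows "k \<le> length Q"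
proof (rule ccontr)
  assume "\<not> k \<le> length Q"
  then have "grow (tableau_shape Q) k k = 1" "grow (tableau_shape Q) k (k - 1) = 0"
    by (auto simp: grow_def tableau_shape_def)
  with antimonoD[OF assms, of "k - 1" k] show False by simp
qed

lemma tableau_add_box:
  "\<lbrakk>tableau Q; \<forall>z\<in>entries Q. z < m; antimono (grow (tableau_shape Q) k)\<rbrakk> \<Longrightarrow> tableau (add_box k m Q)"
proof (induction Q arbitrary: k)
  case Nil
  show ?case by (simp add: above_def)
next
  case (Cons r rs)
  have r: "r \<noteq> []" "sorted_wrt (<) r" "above r (first_row rs)" "set r \<inter> entries rs = {}" "tableau rs"
    and m: "\<forall>z\<in>set r. z < m" "\<forall>z\<in>entries rs. z < m"
    using Cons.prems by auto
  show ?case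
  proof (cases k)
    case 0
    then show ?thesis using r m by (auto simp: sorted_append1 above_def nth_append)
  next
    case (Suc j)
    then have anti: "grow (tableau_shape rs) j 0 \<le> length r" "antimono (grow (tableau_shape rs) j)"
      using Cons.prems(3) by (simp_all add: antimono_case_nat)
    have "above r (first_row (add_box j m rs))"
    proof (cases "j = 0 \<or> rs = []")
      case True
      have "length (first_row rs) < length r"
      proof (cases "rs = []")
        case False
        then show ?thesis using True anti(1) by (simp add: grow_def shape_0 flip: Suc_le_eq)
      qed (use r(1) in simp)
      then show ?thesis using True r(3) m(1)
        by (auto simp: first_row_add_box above_def nth_append less_Suc_eq)
    qed (use r(3) in \<open>simp add: first_row_add_box\<close>)
    then show ?thesis using Suc r m Cons.IH[OF r(5) m(2) anti(2)]
      by (auto simp: entries_add_box)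
  qed
qed

lemma tableau_entries_empty: "tableau T \<Longrightarrow> entries T = {} \<longleftrightarrow> T = []"
  by (cases T) auto

lemma add_box_inj:
  "\<lbrakk>tableau Q; tableau R; m \<notin> entries Q; m \<notin> entries R; k \<le> length Q; j \<le> length R;
    add_box k m Q = add_box j m R\<rbrakk> \<Longrightarrow> Q = R \<and> k = j"
proof (induction Q arbitrary: R k j)
  case Nil
  then show ?case by (cases R; cases j) auto
next
  case (Cons r rs)
  show ?case
  proof (cases R)
    case Nil
    then show ?thesis using Cons.prems by (cases k) auto
  next
    case R: (Cons s ss)
    show ?thesis
    proof (cases k)
      case 0
      then show ?thesis using Cons.prems R by (cases j) auto
    next
      case (Suc k')
      then obtain j' where j: "j = Suc j'" using Cons.prems R by (cases j) auto
      then show ?thesis using Cons.prems R Suc Cons.IH[of ss k' j'] by simp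
    qed
  qed
qed

text \<open>The largest entry has nothing to its right and nothing below it.\<close>

lemma remove_max_box:
  "\<lbrakk>tableau T; m \<in> entries T; \<forall>z\<in>entries T. z \<le> m\<rbrakk> \<Longrightarrow>
     \<exists>k Q. tableau Q \<and> k \<le> length Q \<and> T = add_box k m Q \<and> entries Q = entries T - {m}"
proof (induction T)
  case (Cons r rs)
  have r: "r \<noteq> []" "sorted_wrt (<) r" "above r (first_row rs)" "set r \<inter> entries rs = {}" "tableau rs"
    and max: "\<forall>z\<in>set r. z \<le> m" "\<forall>z\<in>entries rs. z \<le> m"
    using Cons.prems by auto
  show ?case
  proof (cases "m \<in> set r")
    case True
    then obtain r0 r1 where split: "r = r0 @ m # r1" by (meson split_list)
    have "r1 = []"
    proof (cases r1)
      case (Cons y ys)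
      then have "m < y" "y \<le> m" using r(2) max(1) by (auto simp: split sorted_wrt_append)
      then show ?thesis by simp
    qed simp
    then have r0: "r = r0 @ [m]" using split by simp
    have len: "length (first_row rs) \<le> length r0"
    proof (rule ccontr)
      assume *: "\<not> length (first_row rs) \<le> length r0"
      then have "(r0 @ [m]) ! length r0 < first_row rs ! length r0"
        using r(3) unfolding above_def r0 by (meson not_le_imp_less)
      then have "m < first_row rs ! length r0" by simp
      moreover have "first_row rs ! length r0 \<in> entries rs"
        using * by (cases rs) auto
      ultimately show False using max(2) by auto
    qed
    show ?thesis
    proof (cases "r0 = []")
      case True
      then have "rs = []" using len r(5) by (cases rs) auto
      then show ?thesis using r0 True by (intro exI[of _ 0] exI[of _ "[]"]) simp
    next
      case False
      have "m \<notin> set r0" "m \<notin> entries rs" using r(2,4) by (auto simp: r0 sorted_wrt_append)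
      moreover have "tableau (r0 # rs)"
        using r len False by (auto simp: r0 above_def nth_append sorted_wrt_append split: if_splits)
      ultimately show ?thesis
        using r0 by (intro exI[of _ 0] exI[of _ "r0 # rs"]) auto
    qed
  next
    case False
    with Cons.prems have "m \<in> entries rs" by auto
    from Cons.IH[OF r(5) this max(2)] obtain k Q
      where Q: "tableau Q" "k \<le> length Q" "rs = add_box k m Q" "entries Q = entries rs - {m}" by blast
    have "above r (first_row Q)"
      using r(3) unfolding Q(3) first_row_add_box
      by (auto simp: above_def nth_append less_Suc_eq all_conj_distrib split: if_splits)
    then show ?thesis using r Q False
      by (intro exI[of _ "Suc k"] exI[of _ "r # Q"]) auto
  qed
qed simp

section \<open>Standard tableaux\<close>

lemma psize_eq_sum: "finite A \<Longrightarrow> {i. lam i \<noteq> 0} \<subseteq> A \<Longrightarrow> psize lam = sum lam A"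
  unfolding psize_def by (intro sum.mono_neutral_left) auto

lemma psize_shape: "psize (tableau_shape T) = length (concat T)"
proof -
  have "psize (tableau_shape T) = (\<Sum>i<length T. length (T ! i))"
    by (subst psize_eq_sum[of "{..<length T}"]) (auto simp: tableau_shape_def)
  then show ?thesis
    by (simp add: length_concat sum_list_sum_nth atLeast0LessThan)
qed

lemma all_nat_Suc: "(\<forall>n. P n) \<longleftrightarrow> P 0 \<and> (\<forall>n. P (Suc n))"
  by (metis nat.exhaust)

lemma tableau_iff:
  "tableau T \<longleftrightarrow> [] \<notin> set T \<and> antimono (tableau_shape T) \<and> distinct (concat T) \<and>
     (\<forall>r\<in>set T. sorted_wrt (<) r) \<and>
     (\<forall>i j. Suc i < length T \<and> j < length (T ! Suc i) \<longrightarrow> T ! i ! j < T ! Suc i ! j)"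
proof (induction T)
  case Nil
  show ?case by (simp add: antimono_def)
next
  case (Cons r rs)
  have "(\<forall>i j. Suc i < length (r # rs) \<and> j < length ((r # rs) ! Suc i) \<longrightarrow>
                (r # rs) ! i ! j < (r # rs) ! Suc i ! j) \<longleftrightarrow>
        (\<forall>j<length (first_row rs). r ! j < first_row rs ! j) \<and>
        (\<forall>i j. Suc i < length rs \<and> j < length (rs ! Suc i) \<longrightarrow> rs ! i ! j < rs ! Suc i ! j)"
    by (subst all_nat_Suc) (cases rs; auto)
  moreover have "distinct (concat (r # rs)) \<longleftrightarrow>
      distinct r \<and> distinct (concat rs) \<and> set r \<inter> entries rs = {}" by (auto simp: entries_def)
  ultimately show ?case
    using Cons by (auto simp: above_def antimono_case_nat shape_0 strict_sorted_iff)
qed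

lemma shape_in_int_partitions: "tableau T \<Longrightarrow> tableau_shape T \<in> int_partitions"
  using antimono_shape[of T] finite_subset[of "{i. tableau_shape T i \<noteq> 0}" "{..<length T}"]
  by (auto simp: int_partitions_def tableau_shape_def split: if_splits)

lemma psize_shape_card: "tableau T \<Longrightarrow> psize (tableau_shape T) = card (entries T)"
  by (metis tableau_iff psize_shape distinct_card entries_def)

lemma standard_tableau_iff:
  assumes "lam \<in> int_partitions"
  shows "standard_tableau lam T \<longleftrightarrow>
    tableau T \<and> tableau_shape T = lam \<and> entries T = {1..psize lam}"
  using assms unfolding standard_tableau_def tableau_iff int_partitions_def entries_def by auto

section \<open>The Robinson--Schensted correspondence\<close>

lemma new_box_row_eq:
  "tableau_shape P' = grow (tableau_shape P) k \<Longrightarrow> new_box_row P P' = k"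
  unfolding new_box_row_def by (rule Least_equality) (auto simp: grow_def split: if_splits)

lemma robinson_schensted_SucE:
  obtains P Q k where "robinson_schensted \<pi> l = (P, Q)"
    "tableau_shape (tableau_insert (\<pi> (Suc l)) P) = grow (tableau_shape P) k"
    "robinson_schensted \<pi> (Suc l) = (tableau_insert (\<pi> (Suc l)) P, add_box k (Suc l) Q)"
proof -
  obtain P Q where PQ: "robinson_schensted \<pi> l = (P, Q)" by fastforce
  obtain k where "tableau_shape (tableau_insert (\<pi> (Suc l)) P) = grow (tableau_shape P) k"
    using shape_tableau_insert by blast
  with PQ show ?thesis by (intro that[of P Q k]) (auto simp: new_box_row_eq Let_def)
qed

lemma robinson_schensted_cong:
  "(\<And>i. i \<in> {1..l} \<Longrightarrow> \<pi> i = \<rho> i) \<Longrightarrow> robinson_schensted \<pi> l = robinson_schensted \<rho> l"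
  by (induction l) auto

lemma robinson_schensted_sound:
  "\<lbrakk>inj_on \<pi> {1..l}; robinson_schensted \<pi> l = (P, Q)\<rbrakk> \<Longrightarrow>
     tableau P \<and> entries P = \<pi> ` {1..l} \<and> tableau Q \<and> entries Q = {1..l} \<and>
     tableau_shape Q = tableau_shape P"
proof (induction l arbitrary: P Q)
  case (Suc l)
  obtain P0 Q0 k where step: "robinson_schensted \<pi> l = (P0, Q0)"
    "tableau_shape (tableau_insert (\<pi> (Suc l)) P0) = grow (tableau_shape P0) k"
    "robinson_schensted \<pi> (Suc l) = (tableau_insert (\<pi> (Suc l)) P0, add_box k (Suc l) Q0)"
    by (rule robinson_schensted_SucE)
  have inj: "inj_on \<pi> {1..l}" "\<pi> (Suc l) \<notin> \<pi> ` {1..l}"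
    using Suc.prems(1) by (auto simp: atLeastAtMostSuc_conv)
  note IH = Suc.IH[OF inj(1) step(1)]
  have P: "P = tableau_insert (\<pi> (Suc l)) P0" and Q: "Q = add_box k (Suc l) Q0"
    using step(3) Suc.prems(2) by auto
  have tP: "tableau P" unfolding P using IH inj by (intro tableau_tableau_insert) auto
  then have anti: "antimono (grow (tableau_shape Q0) k)"
    using antimono_shape[of P] step(2) IH by (simp add: P)
  then have "tableau Q" unfolding Q using IH by (intro tableau_add_box) auto
  moreover have "tableau_shape Q = tableau_shape P"
    using shape_add_box[OF grow_row_le_length[OF anti]] step(2) IH by (simp add: P Q)
  ultimately show ?case
    using tP IH by (simp add: P Q entries_tableau_insert entries_add_box atLeastAtMostSuc_conv)
qed simp

text \<open>The largest entry of the recording tableau tells where the last insertion ended, hence the shape before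
  it; reversing this insertion recovers the last letter and the pair of tableaux before it.\<close>

lemma robinson_schensted_inj:
  "\<lbrakk>inj_on \<pi> {1..l}; inj_on \<rho> {1..l}; robinson_schensted \<pi> l = robinson_schensted \<rho> l; i \<in> {1..l}\<rbrakk>
     \<Longrightarrow> \<pi> i = \<rho> i"
proof (induction l)
  case (Suc l)
  obtain P Q k where step: "robinson_schensted \<pi> l = (P, Q)"
    "tableau_shape (tableau_insert (\<pi> (Suc l)) P) = grow (tableau_shape P) k"
    "robinson_schensted \<pi> (Suc l) = (tableau_insert (\<pi> (Suc l)) P, add_box k (Suc l) Q)"
    by (rule robinson_schensted_SucE)
  obtain P2 Q2 j where step2: "robinson_schensted \<rho> l = (P2, Q2)"
    "tableau_shape (tableau_insert (\<rho> (Suc l)) P2) = grow (tableau_shape P2) j"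
    "robinson_schensted \<rho> (Suc l) = (tableau_insert (\<rho> (Suc l)) P2, add_box j (Suc l) Q2)"
    by (rule robinson_schensted_SucE)
  have inj: "inj_on \<pi> {1..l}" "inj_on \<rho> {1..l}"
    "\<pi> (Suc l) \<notin> \<pi> ` {1..l}" "\<rho> (Suc l) \<notin> \<rho> ` {1..l}"
    using Suc.prems(1,2) by (auto simp: atLeastAtMostSuc_conv)
  note P = robinson_schensted_sound[OF inj(1) step(1)]
  note P2 = robinson_schensted_sound[OF inj(2) step2(1)]
  have "tableau (tableau_insert (\<pi> (Suc l)) P)" "tableau (tableau_insert (\<rho> (Suc l)) P2)"
    using P P2 inj by (auto intro!: tableau_tableau_insert)
  then have "k \<le> length Q" "j \<le> length Q2"
    using P P2 step(2) step2(2) antimono_shape grow_row_le_length by metis+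
  moreover have "add_box k (Suc l) Q = add_box j (Suc l) Q2"
    using Suc.prems(3) step(3) step2(3) by simp
  ultimately have QQ: "Q = Q2" using P P2 add_box_inj[of Q Q2 "Suc l" k j] by auto
  have "\<pi> (Suc l) = \<rho> (Suc l) \<and> P = P2"
    using P P2 QQ Suc.prems(3) step(3) step2(3) by (intro tableau_insert_inj) auto
  then show ?case using Suc.IH[OF inj(1,2)] Suc.prems(4) step(1) step2(1) QQ 
    by (auto simp: atLeastAtMostSuc_conv)
qed simp

text \<open>The word is built from its last letter backwards: the box of the largest entry of \<open>Q\<close> is removed from
  the shape of \<open>P\<close> by undoing one insertion.\<close>

lemma robinson_schensted_surj:
  "\<lbrakk>tableau P; tableau Q; tableau_shape P = tableau_shape Q; entries Q = {1..l}\<rbrakk> \<Longrightarrow>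
     \<exists>\<pi>. inj_on \<pi> {1..l} \<and> \<pi> ` {1..l} = entries P \<and> robinson_schensted \<pi> l = (P, Q)"
proof (induction l arbitrary: P Q)
  case 0
  then have "Q = []" using tableau_entries_empty[of Q] by simp
  with 0 have "P = []" by (simp add: shape_eq_0_iff)
  with \<open>Q = []\<close> show ?case by simp
next
  case (Suc l)
  have "\<exists>k Q0. tableau Q0 \<and> k \<le> length Q0 \<and> Q = add_box k (Suc l) Q0 \<and> 
      entries Q0 = entries Q - {Suc l}"
    using Suc.prems(4) by (intro remove_max_box[OF Suc.prems(2)]) simp_all
  then obtain k Q0 where Q0: "tableau Q0" "k \<le> length Q0" "Q = add_box k (Suc l) Q0"
    "entries Q0 = {1..l}"
    unfolding Suc.prems(4) by (auto simp: atLeastAtMostSuc_conv)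
  have shape: "tableau_shape P = grow (tableau_shape Q0) k"
    using Suc.prems(3) Q0 by (simp add: shape_add_box)
  from tableau_insert_surj[OF Suc.prems(1) antimono_shape[OF Q0(1)] shape] obtain P0 x
    where P0: "tableau P0" "tableau_shape P0 = tableau_shape Q0" "x \<notin> entries P0"
      "tableau_insert x P0 = P" by blast
  from Suc.IH[OF P0(1) Q0(1) P0(2) Q0(4)] obtain \<pi>
    where \<pi>: "inj_on \<pi> {1..l}" "\<pi> ` {1..l} = entries P0" "robinson_schensted \<pi> l = (P0, Q0)" 
    by blast
  define \<rho> where "\<rho> = \<pi>(Suc l := x)"
  have \<rho>l: "robinson_schensted \<rho> l = (P0, Q0)"
    unfolding \<pi>(3)[symmetric] by (rule robinson_schensted_cong) (simp add: \<rho>_def)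
  obtain P1 Q1 j where step: "robinson_schensted \<rho> l = (P1, Q1)"
    "tableau_shape (tableau_insert (\<rho> (Suc l)) P1) = grow (tableau_shape P1) j"
    "robinson_schensted \<rho> (Suc l) = (tableau_insert (\<rho> (Suc l)) P1, add_box j (Suc l) Q1)"
    by (rule robinson_schensted_SucE)
  have "P1 = P0" "Q1 = Q0" "\<rho> (Suc l) = x" using step(1) \<rho>l by (simp_all add: \<rho>_def)
  then have "robinson_schensted \<rho> (Suc l) = (P, Q)"
    using step(2,3) shape P0 Q0(3) by simp
  moreover have im: "\<rho> ` {1..l} = entries P0"
    unfolding \<pi>(2)[symmetric] by (rule image_cong) (auto simp: \<rho>_def)
  moreover have "inj_on \<rho> {1..l}" using \<pi>(1) by (subst inj_on_cong[of _ _ \<pi>]) (auto simp: \<rho>_def)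
  moreover have "\<rho> (Suc l) = x" by (simp add: \<rho>_def)
  ultimately show ?case using P0(3) entries_tableau_insert[of x P0]
    by (intro exI[of _ \<rho>]) (auto simp: atLeastAtMostSuc_conv P0(4))
qed

lemma bij_robinson_schensted:
  "bij_betw (\<lambda>\<pi>. robinson_schensted \<pi> l) {\<pi>. \<pi> permutes {1..l}}
     {(P, Q). tableau P \<and> tableau Q \<and> tableau_shape P = tableau_shape Q \<and>
              entries P = {1..l} \<and> entries Q = {1..l}}" (is "bij_betw _ ?A ?B")
proof (rule bij_betwI')
  fix \<pi> \<rho> assume "\<pi> \<in> ?A" "\<rho> \<in> ?A"
  then have perm: "\<pi> permutes {1..l}" "\<rho> permutes {1..l}" by auto
  show "(robinson_schensted \<pi> l = robinson_schensted \<rho> l) = (\<pi> = \<rho>)"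
  proof
    assume eq: "robinson_schensted \<pi> l = robinson_schensted \<rho> l"
    have "\<pi> i = \<rho> i" for i
      using robinson_schensted_inj[OF permutes_inj_on permutes_inj_on eq, of _ _ i] perm
      by (cases "i \<in> {1..l}") (metis, metis permutes_not_in)
    then show "\<pi> = \<rho>" by auto
  qed simp
next
  fix \<pi> assume "\<pi> \<in> ?A"
  then have perm: "\<pi> permutes {1..l}" by auto
  obtain P Q where PQ: "robinson_schensted \<pi> l = (P, Q)" by fastforce
  from robinson_schensted_sound[OF permutes_inj_on[OF perm] PQ] permutes_image[OF perm] PQ
  show "robinson_schensted \<pi> l \<in> ?B" by simp
next
  fix PQ assume "PQ \<in> ?B"
  then obtain P Q where PQ: "PQ = (P, Q)" "tableau P" "tableau Q" "tableau_shape P = tableau_shape Q"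
     "entries P = {1..l}" "entries Q = {1..l}" by blast
  from robinson_schensted_surj[OF PQ(2-4,6)] obtain \<pi>
    where \<pi>: "inj_on \<pi> {1..l}" "\<pi> ` {1..l} = {1..l}" "robinson_schensted \<pi> l = (P, Q)"
    unfolding PQ(5) by blast
  \<comment> \<open>\<open>\<pi>\<close> is arbitrary outside \<open>{1..l}\<close>, where a permutation of \<open>{1..l}\<close> is the identity\<close>
  define \<rho> where "\<rho> = (\<lambda>i. if i \<in> {1..l} then \<pi> i else i)"
  have "bij_betw \<rho> {1..l} {1..l}"
    using \<pi>(1,2) by (subst bij_betw_cong[of _ _ \<pi>]) (simp_all add: \<rho>_def bij_betw_def)
  then have "\<rho> permutes {1..l}" by (rule bij_imp_permutes) (auto simp: \<rho>_def)
  moreover have "robinson_schensted \<rho> l = PQ"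
    unfolding PQ(1) \<pi>(3)[symmetric] by (rule robinson_schensted_cong) (simp add: \<rho>_def)
  ultimately show "\<exists>\<pi>\<in>?A. PQ = robinson_schensted \<pi> l" by blast
qed

section \<open>Numbering components and matching them\<close>

lemma half_partitions_iff:
  "\<sigma> \<in> half_partitions n \<longleftrightarrow> partition_on {1..n} (fst \<sigma> \<union> snd \<sigma>) \<and> fst \<sigma> \<inter> snd \<sigma> = {}"
  by (cases \<sigma>) (simp add: half_partitions_def)

text \<open>The properties under which smallest elements exist and are pairwise different.\<close>

definition component_family :: "nat set set \<Rightarrow> bool" where
  "component_family C \<longleftrightarrow> finite C \<and> disjoint C \<and> (\<forall>A\<in>C. A \<noteq> {} \<and> finite A)"

lemma component_family_subset: "component_family D \<Longrightarrow> C \<subseteq> D \<Longrightarrow> component_family C"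
  unfolding component_family_def by (meson finite_subset pairwise_subset subsetD)

lemma component_family_half:
  assumes "\<sigma> \<in> half_partitions n"
  shows "component_family (fst \<sigma> \<union> snd \<sigma>)"
proof -
  have p: "partition_on {1..n} (fst \<sigma> \<union> snd \<sigma>)" using assms by (simp add: half_partitions_iff)
  have "finite A" if "A \<in> fst \<sigma> \<union> snd \<sigma>" for A
    using partition_onD1[OF p] that by (metis Union_upper finite_atLeastAtMost finite_subset)
  then show ?thesis
    using finite_elements[OF _ p] partition_onD2[OF p] partition_onD3[OF p]
    unfolding component_family_def by blast
qed

lemma component_family_unique:
  "component_family C \<Longrightarrow> A \<in> C \<Longrightarrow> B \<in> C \<Longrightarrow> x \<in> A \<Longrightarrow> x \<in> B \<Longrightarrow> A = B"
  unfolding component_family_def disjoint_def by blast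

lemma bij_component_position:
  assumes "component_family C"
  shows "bij_betw (component_position C) C {1..card C}"
proof -
  have C: "finite C" "\<And>A. A \<in> C \<Longrightarrow> A \<noteq> {} \<and> finite A" "disjoint C"
    using assms by (auto simp: component_family_def)
  have less: "component_position C A < component_position C B"
    if "A \<in> C" "B \<in> C" "Min A < Min B" for A B
  proof -
    have "{D \<in> C. Min D \<le> Min A} \<subseteq> {D \<in> C. Min D \<le> Min B}" using that(3) by auto
    moreover have "B \<in> {D \<in> C. Min D \<le> Min B}" "B \<notin> {D \<in> C. Min D \<le> Min A}" using that by auto
    ultimately have "{D \<in> C. Min D \<le> Min A} \<subset> {D \<in> C. Min D \<le> Min B}" by blast
    then show ?thesis unfolding component_position_def using C(1) by (intro psubset_card_mono) auto
  qed
  have Min: "Min A = Min B \<longleftrightarrow> A = B" if "A \<in> C" "B \<in> C" for A B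
    using component_family_unique[OF assms that, of "Min A"] C(2) that by (metis Min_in)
  have inj: "inj_on (component_position C) C"
    by (rule inj_onI) (metis less Min nat_neq_iff)
  have "component_position C A \<in> {1..card C}" if "A \<in> C" for A
  proof -
    have "card {A} \<le> component_position C A" unfolding component_position_def
      by (rule card_mono) (use that C(1) in auto)
    moreover have "component_position C A \<le> card C" unfolding component_position_def
      by (rule card_mono) (use C(1) in auto)
    ultimately show ?thesis by simp
  qed
  then have "component_position C ` C = {1..card C}"
    using inj by (intro card_subset_eq) (auto simp: card_image)
  with inj show ?thesis by (simp add: bij_betw_def)
qed

text \<open>Sets of propagating parts. The whole diagram is absent from the definition because the permutation is
  also taken for a subset of its propagating parts.\<close>

definition matching :: "diagram \<Rightarrow> bool" where
  "matching cs \<longleftrightarrow> finite cs \<and> disjoint cs \<and> (\<forall>c\<in>cs. finite c \<and> Inl -` c \<noteq> {} \<and> Inr -` c \<noteq> {})"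

lemma disjoint_vimage:
  assumes "disjoint cs"
  shows "disjoint ((\<lambda>c. f -` c) ` cs)"
proof (rule disjointI)
  fix a b assume "a \<in> (\<lambda>c. f -` c) ` cs" "b \<in> (\<lambda>c. f -` c) ` cs" "a \<noteq> b"
  then obtain c d where cd: "c \<in> cs" "d \<in> cs" "c \<noteq> d" "a = f -` c" "b = f -` d" by auto
  then have "c \<inter> d = {}" using disjointD[OF assms] by simp
  then show "a \<inter> b = {}" unfolding cd(4,5) by blast
qed

lemma matching_family:
  assumes "matching cs"
  shows "inj_on (\<lambda>c. Inl -` c) cs" "inj_on (\<lambda>c. Inr -` c) cs"
    "component_family ((\<lambda>c. Inl -` c) ` cs)" "component_family ((\<lambda>c. Inr -` c) ` cs)"
proof -
  have cs: "finite cs" "\<And>c. c \<in> cs \<Longrightarrow> finite c \<and> Inl -` c \<noteq> {} \<and> Inr -` c \<noteq> {}"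
    "\<And>c d. c \<in> cs \<Longrightarrow> d \<in> cs \<Longrightarrow> c \<noteq> d \<Longrightarrow> c \<inter> d = {}"
    using assms by (auto simp: matching_def disjoint_def)
  show inj: "inj_on (\<lambda>c. Inl -` c) cs" "inj_on (\<lambda>c. Inr -` c) cs"
  proof -
    show "inj_on (\<lambda>c. Inl -` c) cs"
    proof (rule inj_onI)
      fix c d assume cd: "c \<in> cs" "d \<in> cs" "Inl -` c = Inl -` d"
      then obtain v where "Inl v \<in> c" "Inl v \<in> d" using cs(2) by blast
      then show "c = d" using cs(3)[OF cd(1,2)] by blast
    qed
    show "inj_on (\<lambda>c. Inr -` c) cs"
    proof (rule inj_onI)
      fix c d assume cd: "c \<in> cs" "d \<in> cs" "Inr -` c = Inr -` d"
      then obtain v where "Inr v \<in> c" "Inr v \<in> d" using cs(2) by blast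
      then show "c = d" using cs(3)[OF cd(1,2)] by blast
    qed
  qed
  have fin: "finite (Inl -` c)" "finite (Inr -` c)" if "c \<in> cs" for c
    using cs(2)[OF that] by (auto intro: finite_vimageI)
  have dis: "disjoint ((\<lambda>c. Inl -` c) ` cs)" "disjoint ((\<lambda>c. Inr -` c) ` cs)"
    using assms by (auto simp: matching_def intro!: disjoint_vimage)
  show "component_family ((\<lambda>c. Inl -` c) ` cs)" "component_family ((\<lambda>c. Inr -` c) ` cs)"
    using cs(1,2) fin dis unfolding component_family_def by auto
qed

lemma diagram_part_eq: "c = Inl ` (Inl -` c) \<union> Inr ` (Inr -` c)"
  by (auto simp: image_iff) (metis sumE)

lemma part_eqI: "Inl -` c = Inl -` d \<Longrightarrow> Inr -` c = Inr -` d \<Longrightarrow> c = d"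
  using diagram_part_eq by metis

lemma matching_perm_eq:
  assumes "matching cs" "c \<in> cs"
  shows "matching_perm cs (component_position ((\<lambda>c. Inl -` c) ` cs) (Inl -` c)) =
         component_position ((\<lambda>c. Inr -` c) ` cs) (Inr -` c)"
proof -
  note fam = matching_family[OF assms(1)]
  note bij = bij_component_position[OF fam(3)]
  let ?i = "component_position ((\<lambda>c. Inl -` c) ` cs) (Inl -` c)"
  have "?i \<in> {1..card ((\<lambda>c. Inl -` c) ` cs)}"
    using bij_betwE[OF bij] assms(2) by blast
  then have i: "?i \<in> {1..card cs}" using fam(1) by (simp add: card_image)
  have "d = c" if "d \<in> cs" "component_position ((\<lambda>c. Inl -` c) ` cs) (Inl -` d) = ?i" for d
    using bij_betw_imp_inj_on[OF bij] fam(1) that assms(2) by (metis imageI inj_onD)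
  then show ?thesis
    unfolding matching_perm_def using i assms(2) by (simp, intro the_equality) auto
qed

lemma matching_perm_permutes:
  assumes "matching cs"
  shows "matching_perm cs permutes {1..card cs}"
proof (rule bij_imp_permutes)
  note fam = matching_family[OF assms]
  let ?L = "(\<lambda>c. Inl -` c) ` cs" and ?R = "(\<lambda>c. Inr -` c) ` cs"
  have card: "card ?L = card cs" "card ?R = card cs" using fam by (simp_all add: card_image)
  have L: "component_position ?L ` ?L = {1..card cs}" and R: "component_position ?R ` ?R = {1..card cs}"
    using bij_component_position[OF fam(3)] bij_component_position[OF fam(4)] card
    by (simp_all add: bij_betw_def)
  have "matching_perm cs ` {1..card cs} = (\<lambda>c. component_position ?R (Inr -` c)) ` cs"
    unfolding L[symmetric] image_image
    by (rule image_cong) (simp_all add: matching_perm_eq[OF assms])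
  also have "\<dots> = {1..card cs}" unfolding R[symmetric] image_image ..
  finally have im: "matching_perm cs ` {1..card cs} = {1..card cs}" .
  then show "bij_betw (matching_perm cs) {1..card cs} {1..card cs}"
    by (simp add: bij_betw_def eq_card_imp_inj_on)
qed (auto simp: matching_perm_def)

text \<open>The permutation determines which component on the right belongs to a component on the left, and a part
  is the union of its two traces.\<close>

lemma matching_subset_if_perm_eq:
  assumes "matching cs" "matching ds"
    and L: "(\<lambda>c. Inl -` c) ` cs = (\<lambda>c. Inl -` c) ` ds"
    and R: "(\<lambda>c. Inr -` c) ` cs = (\<lambda>c. Inr -` c) ` ds"
    and eq: "matching_perm cs = matching_perm ds"
  shows "cs \<subseteq> ds"
proof
  fix c assume c: "c \<in> cs"
  then have "Inl -` c \<in> (\<lambda>c. Inl -` c) ` ds" unfolding L[symmetric] by (rule imageI)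
  then obtain d where d: "d \<in> ds" "Inl -` c = Inl -` d" by (rule imageE) simp
  have "component_position ((\<lambda>c. Inr -` c) ` ds) (Inr -` c) =
        component_position ((\<lambda>c. Inr -` c) ` ds) (Inr -` d)"
    using matching_perm_eq[OF assms(1) c] matching_perm_eq[OF assms(2) d(1)] L R eq d(2) by simp
  then have "Inr -` c = Inr -` d"
    using bij_betw_imp_inj_on[OF bij_component_position[OF matching_family(4)[OF assms(2)]]] c d(1) R
    by (metis imageI inj_onD)
  then show "c \<in> ds" using d part_eqI by metis
qed

section \<open>Diagrams and half-partitions with a marked vertex\<close>

text \<open>If \<open>x\<close> is not a vertex, nothing is required and these are all diagrams; if \<open>x\<close> is the last vertex, they
  are the diagrams in which \<open>x\<close> and \<open>x'\<close> are joined.\<close>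

definition marked_diagrams :: "nat \<Rightarrow> nat \<Rightarrow> diagram set" where
  "marked_diagrams x n = {p \<in> Cp n. x \<in> {1..n} \<longrightarrow> (\<exists>c\<in>p. Inl x \<in> c \<and> Inr x \<in> c)}"

text \<open>The number \<open>l\<close> counts the propagating components without \<open>x\<close>, which are those that the permutation
  acts on.\<close>

definition marked_halves :: "nat \<Rightarrow> nat \<Rightarrow> nat \<Rightarrow> half_partition set" where
  "marked_halves x n l = {\<sigma> \<in> half_partitions n.
     card {A \<in> snd \<sigma>. x \<notin> A} = l \<and> (x \<in> {1..n} \<longrightarrow> (\<exists>A\<in>snd \<sigma>. x \<in> A))}"

definition free_parts :: "nat \<Rightarrow> diagram \<Rightarrow> diagram" where
  "free_parts x p = {c \<in> propagating_parts p. Inl x \<notin> c}"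

lemma CpD:
  assumes "p \<in> Cp n"
  shows "finite p" "c \<in> p \<Longrightarrow> c \<noteq> {}" "c \<in> p \<Longrightarrow> d \<in> p \<Longrightarrow> v \<in> c \<Longrightarrow> v \<in> d \<Longrightarrow> c = d"
    "c \<in> p \<Longrightarrow> finite c" "\<Union>p = Inl ` {1..n} \<union> Inr ` {1..n}" "c \<in> p \<Longrightarrow> Inl x \<in> c \<Longrightarrow> x \<in> {1..n}"
    "c \<in> p \<Longrightarrow> Inr x \<in> c \<Longrightarrow> x \<in> {1..n}"
proof -
  have p: "partition_on (Inl ` {1..n} \<union> Inr ` {1..n}) p" using assms by (simp add: Cp_def)
  show U: "\<Union>p = Inl ` {1..n} \<union> Inr ` {1..n}" using partition_onD1[OF p] by simp
  show "finite p" by (rule finite_elements[OF _ p]) simp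
  show "c \<noteq> {}" if "c \<in> p" using partition_onD3[OF p] that by auto
  show "c = d" if "c \<in> p" "d \<in> p" "v \<in> c" "v \<in> d"
    using partition_onD2[OF p] that by (auto simp: disjoint_def)
  show "finite c" if "c \<in> p"
    by (rule finite_subset[of _ "Inl ` {1..n} \<union> Inr ` {1..n}"]) (use U that in auto)
  show "x \<in> {1..n}" if "c \<in> p" "Inl x \<in> c" using U that by blast
  show "x \<in> {1..n}" if "c \<in> p" "Inr x \<in> c" using U that by blast
qed

lemma propagating_parts_iff:
  "c \<in> propagating_parts p \<longleftrightarrow> c \<in> p \<and> Inl -` c \<noteq> {} \<and> Inr -` c \<noteq> {}"
  by (auto simp: propagating_parts_def)

lemma matching_propagating_parts:
  assumes "p \<in> Cp n" "cs \<subseteq> propagating_parts p"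
  shows "matching cs"
proof -
  have part: "c \<in> p" "Inl -` c \<noteq> {}" "Inr -` c \<noteq> {}" if "c \<in> cs" for c
    using subsetD[OF assms(2) that] by (simp_all add: propagating_parts_iff)
  have "finite cs" by (rule finite_subset[OF _ CpD(1)[OF assms(1)]]) (use part(1) in auto)
  moreover have "disjoint cs"
  proof (rule disjointI)
    show "c \<inter> d = {}" if "c \<in> cs" "d \<in> cs" "c \<noteq> d" for c d
      using CpD(3)[OF assms(1) part(1)[OF that(1)] part(1)[OF that(2)]] that(3) by blast
  qed
  ultimately show ?thesis using part CpD(4)[OF assms(1)] by (simp add: matching_def)
qed

lemma subset_range_Inl_iff: "c \<subseteq> range Inl \<longleftrightarrow> Inr -` c = {}"
  by (simp add: subset_iff split_sum_all image_iff vimage_def)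

lemma subset_range_Inr_iff: "c \<subseteq> range Inr \<longleftrightarrow> Inl -` c = {}"
  by (simp add: subset_iff split_sum_all image_iff vimage_def)

text \<open>Used for the inclusion of the vertices of either side; \<open>S\<close> are the parts confined to this side and \<open>T\<close>
  the propagating ones.\<close>

lemma traces_in_half_partitions:
  assumes p: "partition_on X p" and X: "f -` X = {1..n}"
    and cover: "S \<union> T = {c \<in> p. f -` c \<noteq> {}}" and ST: "S \<inter> T = {}"
  shows "((\<lambda>c. f -` c) ` S, (\<lambda>c. f -` c) ` T) \<in> half_partitions n"
proof -
  have "(\<lambda>c. f -` c) ` S \<union> (\<lambda>c. f -` c) ` T = (-`) f ` p - {{}}"
    using cover by (auto simp flip: image_Un)
  moreover have "(\<lambda>c. f -` c) ` S \<inter> (\<lambda>c. f -` c) ` T = {}"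
  proof -
    have "f -` c \<noteq> f -` d" if "c \<in> S" "d \<in> T" for c d
    proof
      assume eq: "f -` c = f -` d"
      have cd: "c \<in> p" "f -` c \<noteq> {}" "d \<in> p" using cover that by blast+
      then obtain v where "f v \<in> c" by auto
      moreover from this eq have "f v \<in> d" by blast
      ultimately have "c = d" using partition_onD2[OF p] cd by (auto simp: disjoint_def)
      with that ST show False by blast
    qed
    then show ?thesis by blast
  qed
  ultimately show ?thesis
    using partition_on_vimage[OF p, of f] X by (simp add: half_partitions_iff)
qed

lemma halves_in_half_partitions:
  assumes "p \<in> Cp n"
  shows "left_half p \<in> half_partitions n" "right_half p \<in> half_partitions n"
proof -
  have p: "partition_on (Inl ` {1..n} \<union> Inr ` {1..n}) p" using assms by (simp add: Cp_def)
  have ne: "Inl -` c \<noteq> {} \<or> Inr -` c \<noteq> {}" if "c \<in> p" for c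
    using CpD(2)[OF assms that] part_eqI[of c "{}"] by auto
  have X: "Inl -` (Inl ` {1..n} \<union> Inr ` {1..n} :: (nat + nat) set) = {1..n}"
    "Inr -` (Inl ` {1..n} \<union> Inr ` {1..n} :: (nat + nat) set) = {1..n}" by auto
  show "left_half p \<in> half_partitions n"
    unfolding left_half_def
  proof (rule traces_in_half_partitions[OF p X(1)])
    show "{c \<in> p. c \<subseteq> range Inl} \<union> propagating_parts p = {c \<in> p. Inl -` c \<noteq> {}}" (is "?lhs = ?rhs")
    proof (rule set_eqI)
      show "c \<in> ?lhs \<longleftrightarrow> c \<in> ?rhs" for c
        unfolding Un_iff mem_Collect_eq propagating_parts_iff subset_range_Inl_iff using ne[of c] by metis
    qed
    show "{c \<in> p. c \<subseteq> range Inl} \<inter> propagating_parts p = {}"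
      unfolding subset_range_Inl_iff disjoint_iff by (simp add: propagating_parts_iff)
  qed
  show "right_half p \<in> half_partitions n"
    unfolding right_half_def
  proof (rule traces_in_half_partitions[OF p X(2)])
    show "{c \<in> p. c \<subseteq> range Inr} \<union> propagating_parts p = {c \<in> p. Inr -` c \<noteq> {}}" (is "?lhs = ?rhs")
    proof (rule set_eqI)
      show "c \<in> ?lhs \<longleftrightarrow> c \<in> ?rhs" for c
        unfolding Un_iff mem_Collect_eq propagating_parts_iff subset_range_Inr_iff using ne[of c] by metis
    qed
    show "{c \<in> p. c \<subseteq> range Inr} \<inter> propagating_parts p = {}"
      unfolding subset_range_Inr_iff disjoint_iff by (simp add: propagating_parts_iff)
  qed
qed

text \<open>Hence it does not matter on which side the part through the marked vertex is recognised, although the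
  condition defining \<open>free_parts\<close> looks at the unprimed side only.\<close>

lemma marked_part_iff:
  assumes "p \<in> marked_diagrams x n" "c \<in> p"
  shows "Inl x \<in> c \<longleftrightarrow> Inr x \<in> c"
proof -
  have p: "p \<in> Cp n" using assms(1) by (simp add: marked_diagrams_def)
  show ?thesis
  proof (cases "x \<in> {1..n}")
    case True
    then obtain d where "d \<in> p" "Inl x \<in> d" "Inr x \<in> d"
      using assms(1) by (auto simp: marked_diagrams_def)
    then show ?thesis using CpD(3)[OF p assms(2)] by metis
  next
    case False
    then show ?thesis using CpD(6,7)[OF p assms(2)] by blast
  qed
qed

lemma free_components:
  assumes "p \<in> marked_diagrams x n"
  shows "{A \<in> snd (left_half p). x \<notin> A} = (\<lambda>c. Inl -` c) ` free_parts x p"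
    "{A \<in> snd (right_half p). x \<notin> A} = (\<lambda>c. Inr -` c) ` free_parts x p"
proof -
  show "{A \<in> snd (left_half p). x \<notin> A} = (\<lambda>c. Inl -` c) ` free_parts x p"
    by (auto simp: left_half_def free_parts_def)
  have "free_parts x p = {c \<in> propagating_parts p. Inr x \<notin> c}"
    using marked_part_iff[OF assms] by (auto simp: free_parts_def propagating_parts_def)
  then show "{A \<in> snd (right_half p). x \<notin> A} = (\<lambda>c. Inr -` c) ` free_parts x p"
    by (auto simp: right_half_def)
qed

lemma matching_free_parts: "p \<in> marked_diagrams x n \<Longrightarrow> matching (free_parts x p)"
  by (rule matching_propagating_parts[of p n]) (auto simp: marked_diagrams_def free_parts_def)

lemma halves_marked:
  assumes "p \<in> marked_diagrams x n"
  shows "left_half p \<in> marked_halves x n (card (free_parts x p))"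
    "right_half p \<in> marked_halves x n (card (free_parts x p))"
proof -
  have p: "p \<in> Cp n" using assms(1) by (simp add: marked_diagrams_def)
  note inj = matching_family(1,2)[OF matching_free_parts[OF assms]]
  have "\<exists>c\<in>propagating_parts p. Inl x \<in> c \<and> Inr x \<in> c" if "x \<in> {1..n}"
  proof -
    obtain c where "c \<in> p" "Inl x \<in> c" "Inr x \<in> c" using assms \<open>x \<in> {1..n}\<close> by (auto simp: marked_diagrams_def)
    then have "c \<in> propagating_parts p" by (auto simp: propagating_parts_def)
    with \<open>Inl x \<in> c\<close> \<open>Inr x \<in> c\<close> show ?thesis by blast
  qed
  then show "left_half p \<in> marked_halves x n (card (free_parts x p))"
    "right_half p \<in> marked_halves x n (card (free_parts x p))"
    using halves_in_half_partitions[OF p] inj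
    unfolding marked_halves_def mem_Collect_eq free_components[OF assms]
    by (auto simp: card_image left_half_def right_half_def)
qed

text \<open>Non-propagating parts are recorded in the two halves, unmarked propagating parts by the permutation,
  and the marked part is the union of the two components that contain the marked vertex.\<close>

lemma marked_diagram_subset:
  assumes p: "p \<in> marked_diagrams x n" and q: "q \<in> marked_diagrams x n"
    and L: "left_half p = left_half q" and R: "right_half p = right_half q"
    and perm: "matching_perm (free_parts x p) = matching_perm (free_parts x q)"
  shows "p \<subseteq> q"
proof
  fix c assume c: "c \<in> p"
  have pC: "p \<in> Cp n" and qC: "q \<in> Cp n" using p q by (auto simp: marked_diagrams_def)
  have "free_parts x p \<subseteq> free_parts x q"
    by (rule matching_subset_if_perm_eq[OF matching_free_parts[OF p] matching_free_parts[OF q] _ _ perm])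
      (simp_all flip: free_components[OF p] free_components[OF q] add: L R)
  then have free: "d \<in> q" if "d \<in> free_parts x p" for d
    using that by (auto simp: free_parts_def propagating_parts_iff)
  consider "Inr -` c = {}" | "Inl -` c = {}" | "c \<in> free_parts x p"
    | "c \<in> propagating_parts p" "Inl x \<in> c" "Inr x \<in> c"
    using c marked_part_iff[OF p c] by (auto simp: free_parts_def propagating_parts_iff)
  then show "c \<in> q"
  proof cases
    case 1
    then have "Inl -` c \<in> fst (left_half p)" using c by (auto simp: left_half_def subset_range_Inl_iff)
    then obtain d where "d \<in> q" "Inr -` d = {}" "Inl -` d = Inl -` c"
      unfolding L by (auto simp: left_half_def subset_range_Inl_iff)
    then show ?thesis using 1 part_eqI by metis
  next
    case 2
    then have "Inr -` c \<in> fst (right_half p)" using c by (auto simp: right_half_def subset_range_Inr_iff)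
    then obtain d where "d \<in> q" "Inl -` d = {}" "Inr -` d = Inr -` c"
      unfolding R by (auto simp: right_half_def subset_range_Inr_iff)
    then show ?thesis using 2 part_eqI by metis
  next
    case 4
    then have "Inl -` c \<in> snd (left_half p)" "Inr -` c \<in> snd (right_half p)"
      by (auto simp: left_half_def right_half_def)
    then have "Inl -` c \<in> (\<lambda>c. Inl -` c) ` propagating_parts q"
      "Inr -` c \<in> (\<lambda>c. Inr -` c) ` propagating_parts q"
      unfolding L R by (simp_all add: left_half_def right_half_def)
    then obtain d e where "d \<in> propagating_parts q" "Inl -` c = Inl -` d"
      and "e \<in> propagating_parts q" "Inr -` c = Inr -` e" by (elim imageE)
    then have d: "d \<in> q" "Inl -` d = Inl -` c" and e: "e \<in> q" "Inr -` e = Inr -` c"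
      by (simp_all add: propagating_parts_iff)
    have "Inr x \<in> d" using marked_part_iff[OF q d(1)] d(2) 4(2) by blast
    moreover have "Inr x \<in> e" using e(2) 4(3) by blast
    ultimately have "d = e" using CpD(3)[OF qC d(1) e(1)] by blast
    then show ?thesis using d e part_eqI by metis
  qed (rule free)
qed

section \<open>Gluing two half-partitions\<close>

definition strand :: "nat set \<Rightarrow> nat set \<Rightarrow> (nat + nat) set" where
  "strand A B = Inl ` A \<union> Inr ` B"

lemma vimage_strand [simp]: "Inl -` strand A B = A" "Inr -` strand A B = B"
  by (auto simp: strand_def)

lemma strand_eq_iff [simp]: "strand A B = strand A' B' \<longleftrightarrow> A = A' \<and> B = B'"
  by (metis vimage_strand)

lemma mem_strand [simp]: "Inl x \<in> strand A B \<longleftrightarrow> x \<in> A" "Inr x \<in> strand A B \<longleftrightarrow> x \<in> B"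
  by (auto simp: strand_def)

definition glue :: "half_partition \<Rightarrow> half_partition \<Rightarrow> (nat set \<Rightarrow> nat set) \<Rightarrow> diagram" where
  "glue \<sigma> \<tau> \<beta> = (\<lambda>A. strand A {}) ` fst \<sigma> \<union> strand {} ` fst \<tau> \<union> (\<lambda>A. strand A (\<beta> A)) ` snd \<sigma>"

text \<open>Parts are disjoint because on each side their traces are components of one set partition, and a trace
  belongs to a single part.\<close>

lemma halves_glue:
  assumes \<sigma>: "\<sigma> \<in> half_partitions n" and \<tau>: "\<tau> \<in> half_partitions n"
    and \<beta>: "bij_betw \<beta> (snd \<sigma>) (snd \<tau>)"
  shows "glue \<sigma> \<tau> \<beta> \<in> Cp n"
    and "propagating_parts (glue \<sigma> \<tau> \<beta>) = (\<lambda>A. strand A (\<beta> A)) ` snd \<sigma>"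
    and "left_half (glue \<sigma> \<tau> \<beta>) = \<sigma>" and "right_half (glue \<sigma> \<tau> \<beta>) = \<tau>"
proof -
  have p\<sigma>: "partition_on {1..n} (fst \<sigma> \<union> snd \<sigma>)" and p\<tau>: "partition_on {1..n} (fst \<tau> \<union> snd \<tau>)"
    and i\<sigma>: "fst \<sigma> \<inter> snd \<sigma> = {}" and i\<tau>: "fst \<tau> \<inter> snd \<tau> = {}"
    using \<sigma> \<tau> by (auto simp: half_partitions_iff)
  have U\<sigma>: "\<Union>(fst \<sigma> \<union> snd \<sigma>) = {1..n}" and U\<tau>: "\<Union>(fst \<tau> \<union> snd \<tau>) = {1..n}"
    using partition_onD1[OF p\<sigma>] partition_onD1[OF p\<tau>] by auto
  have ne: "{} \<notin> fst \<sigma>" "{} \<notin> snd \<sigma>" "{} \<notin> fst \<tau>" "{} \<notin> snd \<tau>"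
    using partition_onD3[OF p\<sigma>] partition_onD3[OF p\<tau>] by auto
  have \<beta>im: "\<beta> ` snd \<sigma> = snd \<tau>" and \<beta>inj: "inj_on \<beta> (snd \<sigma>)" using \<beta> by (auto simp: bij_betw_def)
  have \<beta>ne: "\<beta> A \<noteq> {}" if "A \<in> snd \<sigma>" for A using \<beta>im ne(4) that by blast
  let ?p = "glue \<sigma> \<tau> \<beta>"
  show pp: "propagating_parts ?p = (\<lambda>A. strand A (\<beta> A)) ` snd \<sigma>"
  proof (intro equalityI subsetI)
    fix c assume "c \<in> (\<lambda>A. strand A (\<beta> A)) ` snd \<sigma>"
    then obtain A where A: "A \<in> snd \<sigma>" "c = strand A (\<beta> A)" by blast
    then have "A \<noteq> {}" using ne(2) by auto
    with A show "c \<in> propagating_parts ?p"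
      using \<beta>ne[OF A(1)] by (simp add: propagating_parts_iff glue_def)
  qed (auto simp: propagating_parts_iff glue_def)
  show "left_half ?p = \<sigma>"
  proof (rule prod_eqI)
    show "snd (left_half ?p) = snd \<sigma>" unfolding left_half_def pp by (simp add: image_image)
    have "{c \<in> ?p. c \<subseteq> range Inl} = (\<lambda>A. strand A {}) ` fst \<sigma>"
      using ne \<beta>ne by (auto simp: subset_range_Inl_iff glue_def)
    then show "fst (left_half ?p) = fst \<sigma>" by (simp add: left_half_def image_image)
  qed
  show "right_half ?p = \<tau>"
  proof (rule prod_eqI)
    show "snd (right_half ?p) = snd \<tau>" unfolding right_half_def pp by (simp add: image_image \<beta>im)
    have "{c \<in> ?p. c \<subseteq> range Inr} = strand {} ` fst \<tau>"
      using ne \<beta>ne by (auto simp: subset_range_Inr_iff glue_def)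
    then show "fst (right_half ?p) = fst \<tau>" by (simp add: right_half_def image_image)
  qed
  have "\<Union>?p = Inl ` (\<Union>(fst \<sigma> \<union> snd \<sigma>)) \<union> Inr ` (\<Union>(fst \<tau> \<union> snd \<tau>))"
    unfolding \<beta>im[symmetric] by (auto simp: glue_def strand_def)
  then have "\<Union>?p = Inl ` {1..n} \<union> Inr ` {1..n}" unfolding U\<sigma> U\<tau> .
  moreover have "{} \<notin> ?p"
    using ne by (auto simp: glue_def strand_def)
  moreover have "disjoint ?p"
  proof (rule disjointI)
    note f\<sigma> = component_family_unique[OF component_family_half[OF \<sigma>]]
    note f\<tau> = component_family_unique[OF component_family_half[OF \<tau>]]
    have \<beta>mem: "\<beta> A \<in> snd \<tau>" if "A \<in> snd \<sigma>" for A using \<beta>im that by auto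
    have parts: "Inl -` c \<in> fst \<sigma> \<union> snd \<sigma>" if "c \<in> ?p" "Inl v \<in> c" for c v
      using that by (auto simp: glue_def)
    have parts': "Inr -` c \<in> fst \<tau> \<union> snd \<tau>" if "c \<in> ?p" "Inr v \<in> c" for c v
      using that \<beta>mem by (auto simp: glue_def)
    have eq1: "c = d" if "c \<in> ?p" "d \<in> ?p" "Inl -` c = Inl -` d" "Inl -` c \<noteq> {}" for c d
      using that i\<sigma> by (auto simp: glue_def)
    have eq2: "c = d" if "c \<in> ?p" "d \<in> ?p" "Inr -` c = Inr -` d" "Inr -` c \<noteq> {}" for c d
      using that i\<tau> \<beta>mem by (auto simp: glue_def inj_on_eq_iff[OF \<beta>inj])
    show "c \<inter> d = {}" if cd: "c \<in> ?p" "d \<in> ?p" "c \<noteq> d" for c d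
    proof (rule ccontr)
      assume "c \<inter> d \<noteq> {}"
      then obtain w where w: "w \<in> c" "w \<in> d" by auto
      show False
      proof (cases w)
        case (Inl v)
        then have "Inl -` c = Inl -` d" using f\<sigma>[of "Inl -` c" "Inl -` d" v] parts cd w by simp
        then show False using eq1[OF cd(1,2)] cd(3) w Inl by auto
      next
        case (Inr v)
        then have "Inr -` c = Inr -` d" using f\<tau>[of "Inr -` c" "Inr -` d" v] parts' cd w by simp
        then show False using eq2[OF cd(1,2)] cd(3) w Inr by auto
      qed
    qed
  qed
  ultimately show "?p \<in> Cp n" by (simp add: Cp_def partition_on_def)
qed

lemma components_subset: "\<sigma> \<in> half_partitions n \<Longrightarrow> A \<in> snd \<sigma> \<Longrightarrow> A \<subseteq> {1..n}"
  using partition_onD1[of "{1..n}" "fst \<sigma> \<union> snd \<sigma>"] by (auto simp: half_partitions_iff)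

lemma marked_component_unique:
  assumes "\<sigma> \<in> marked_halves x n l"
  shows "x \<in> {1..n} \<Longrightarrow> \<exists>A. {A \<in> snd \<sigma>. x \<in> A} = {A}" "x \<notin> {1..n} \<Longrightarrow> {A \<in> snd \<sigma>. x \<in> A} = {}"
proof -
  have \<sigma>: "\<sigma> \<in> half_partitions n" using assms by (simp add: marked_halves_def)
  show "\<exists>A. {A \<in> snd \<sigma>. x \<in> A} = {A}" if "x \<in> {1..n}"
  proof -
    obtain A where A: "A \<in> snd \<sigma>" "x \<in> A"
      using assms \<open>x \<in> _\<close> by (auto simp: marked_halves_def)
    have "B = A" if "B \<in> snd \<sigma>" "x \<in> B" for B
      by (rule component_family_unique[OF component_family_half[OF \<sigma>]]) (use A that in auto)
    with A have "{A \<in> snd \<sigma>. x \<in> A} = {A}" by blast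
    then show ?thesis ..
  qed
  show "{A \<in> snd \<sigma>. x \<in> A} = {}" if "x \<notin> {1..n}"
    using components_subset[OF \<sigma>] that by blast
qed

text \<open>The bijection between the unmarked components is the permutation read through their numberings; the
  marked components, one or none on each side, are matched with each other.\<close>

lemma marked_diagram_exists:
  assumes \<sigma>: "\<sigma> \<in> marked_halves x n l" and \<tau>: "\<tau> \<in> marked_halves x n l" and \<pi>: "\<pi> permutes {1..l}"
  shows "\<exists>p\<in>marked_diagrams x n. left_half p = \<sigma> \<and> right_half p = \<tau> \<and>
    matching_perm (free_parts x p) = \<pi> \<and> card (free_parts x p) = l"
proof -
  have h: "\<sigma> \<in> half_partitions n" "\<tau> \<in> half_partitions n"
    using \<sigma> \<tau> by (auto simp: marked_halves_def)
  define L R where "L = {A \<in> snd \<sigma>. x \<notin> A}" and "R = {B \<in> snd \<tau>. x \<notin> B}"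
  have card: "card L = l" "card R = l" using \<sigma> \<tau> by (auto simp: L_def R_def marked_halves_def)
  have "component_family L"
    by (rule component_family_subset[OF component_family_half[OF h(1)]]) (auto simp: L_def)
  moreover have "component_family R"
    by (rule component_family_subset[OF component_family_half[OF h(2)]]) (auto simp: R_def)
  ultimately have posL: "bij_betw (component_position L) L {1..l}" and posR: "bij_betw (component_position R) R {1..l}"
    using bij_component_position card by metis+
  \<comment> \<open>\<open>\<gamma>\<close> matches the unmarked components, \<open>\<delta>\<close> the marked ones\<close>
  define \<gamma> where "\<gamma> = (inv_into R (component_position R) \<circ> (\<pi> \<circ> component_position L))"
  have \<gamma>: "bij_betw \<gamma> L R" unfolding \<gamma>_def
    using bij_betw_trans[OF bij_betw_trans[OF posL permutes_imp_bij[OF \<pi>]] bij_betw_inv_into[OF posR]] .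
  have pos\<gamma>: "component_position R (\<gamma> A) = \<pi> (component_position L A)" if "A \<in> L" for A
    unfolding \<gamma>_def comp_apply
    by (rule bij_betw_inv_into_right[OF posR])
      (use that posL permutes_in_image[OF \<pi>] in \<open>auto dest!: bij_betwE\<close>)
  obtain \<delta> where \<delta>: "bij_betw \<delta> {A \<in> snd \<sigma>. x \<in> A} {B \<in> snd \<tau>. x \<in> B}"
  proof (cases "x \<in> {1..n}")
    case True
    then obtain A B where "{A \<in> snd \<sigma>. x \<in> A} = {A}" "{B \<in> snd \<tau>. x \<in> B} = {B}"
      using marked_component_unique(1) \<sigma> \<tau> by meson
    then show ?thesis by (intro that[of "\<lambda>_. B"]) (simp add: bij_betw_def)
  next
    case False
    show ?thesis
      by (rule that[of id], unfold marked_component_unique(2)[OF \<sigma> False]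
          marked_component_unique(2)[OF \<tau> False]) (simp add: bij_betw_def)
  qed
  define \<beta> where "\<beta> A = (if x \<in> A then \<delta> A else \<gamma> A)" for A
  have "bij_betw \<beta> L R"
    using \<gamma> by (rule bij_betw_cong[THEN iffD1, rotated]) (simp add: \<beta>_def L_def)
  moreover have "bij_betw \<beta> {A \<in> snd \<sigma>. x \<in> A} {B \<in> snd \<tau>. x \<in> B}"
    using \<delta> by (rule bij_betw_cong[THEN iffD1, rotated]) (simp add: \<beta>_def)
  ultimately have "bij_betw \<beta> (L \<union> {A \<in> snd \<sigma>. x \<in> A}) (R \<union> {B \<in> snd \<tau>. x \<in> B})"
    by (rule bij_betw_combine) (auto simp: R_def)
  moreover have "L \<union> {A \<in> snd \<sigma>. x \<in> A} = snd \<sigma>" "R \<union> {B \<in> snd \<tau>. x \<in> B} = snd \<tau>"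
    by (auto simp: L_def R_def)
  ultimately have \<beta>: "bij_betw \<beta> (snd \<sigma>) (snd \<tau>)" by simp
  define p where "p = glue \<sigma> \<tau> \<beta>"
  note glue = halves_glue[OF h \<beta>, folded p_def]
  have \<beta>x: "x \<in> \<beta> A" if "A \<in> snd \<sigma>" "x \<in> A" for A
    using bij_betwE[OF \<delta>] that by (auto simp: \<beta>_def)
  have p: "p \<in> marked_diagrams x n"
  proof -
    have "\<exists>c\<in>p. Inl x \<in> c \<and> Inr x \<in> c" if "x \<in> {1..n}"
    proof -
      obtain A where "A \<in> snd \<sigma>" "x \<in> A" using \<sigma> \<open>x \<in> {1..n}\<close> by (auto simp: marked_halves_def)
      then show ?thesis using \<beta>x by (auto simp: p_def glue_def intro!: bexI[of _ "strand A (\<beta> A)"])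
    qed
    then show ?thesis using glue(1) by (auto simp: marked_diagrams_def)
  qed
  have free: "free_parts x p = (\<lambda>A. strand A (\<beta> A)) ` L"
    unfolding free_parts_def glue(2) by (auto simp: L_def)
  have cardp: "card (free_parts x p) = l"
    unfolding free by (subst card_image) (auto simp: inj_on_def card)
  have LR: "(\<lambda>c. Inl -` c) ` free_parts x p = L" "(\<lambda>c. Inr -` c) ` free_parts x p = R"
    using free_components[OF p] glue(3,4) by (simp_all add: L_def R_def)
  note m = matching_free_parts[OF p]
  have "matching_perm (free_parts x p) i = \<pi> i" for i
  proof (cases "i \<in> {1..l}")
    case True
    then have "i \<in> component_position L ` L" using bij_betw_imp_surj_on[OF posL] by simp
    then obtain A where A: "A \<in> L" "i = component_position L A" by blast
    have "matching_perm (free_parts x p) i = component_position R (\<beta> A)"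
      using matching_perm_eq[OF m, of "strand A (\<beta> A)"] A unfolding LR by (auto simp: free)
    also have "\<beta> A = \<gamma> A" using A by (simp add: \<beta>_def L_def)
    finally show ?thesis using pos\<gamma>[OF A(1)] A(2) by simp
  next
    case False
    then show ?thesis using matching_perm_permutes[OF m] \<pi> cardp by (metis permutes_not_in)
  qed
  then have "matching_perm (free_parts x p) = \<pi>" by auto
  with p glue(3,4) cardp show ?thesis by blast
qed

section \<open>The bra-ket decomposition\<close>

lemma bij_bra_ket_marked:
  "bij_betw (\<lambda>p. bra_ket_wrt (free_parts x p) p) (marked_diagrams x n)
     (SIGMA lam:int_partitions.
        (marked_halves x n (psize lam) \<times> {T. standard_tableau lam T}) \<times>
        (marked_halves x n (psize lam) \<times> {T. standard_tableau lam T}))"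
  (is "bij_betw ?f ?A ?B")
proof (rule bij_betwI')
  fix p q assume p: "p \<in> ?A" and q: "q \<in> ?A"
  show "(?f p = ?f q) = (p = q)"
  proof
    assume eq: "?f p = ?f q"
    then have LR: "left_half p = left_half q" "right_half p = right_half q"
      and rs: "robinson_schensted (matching_perm (free_parts x p)) (card (free_parts x p)) =
               robinson_schensted (matching_perm (free_parts x q)) (card (free_parts x q))"
      by (auto simp: bra_ket_wrt_def split: prod.splits)
    have card: "card (free_parts x p) = card (free_parts x q)"
      using halves_marked(1)[OF p] halves_marked(1)[OF q] LR by (simp add: marked_halves_def)
    have "matching_perm (free_parts x p) = matching_perm (free_parts x q)"
      using bij_betw_imp_inj_on[OF bij_robinson_schensted] rs
        matching_perm_permutes[OF matching_free_parts[OF p]]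
        matching_perm_permutes[OF matching_free_parts[OF q]]
      unfolding card inj_on_def by blast
    then show "p = q"
      using marked_diagram_subset[OF p q] marked_diagram_subset[OF q p] LR by auto
  qed simp
next
  fix p assume p: "p \<in> ?A"
  obtain P Q where PQ: 
    "robinson_schensted (matching_perm (free_parts x p)) (card (free_parts x p)) = (P, Q)" by fastforce
  let ?l = "card (free_parts x p)"
  have "(P, Q) \<in> {(P, Q). tableau P \<and> tableau Q \<and> tableau_shape P = tableau_shape Q \<and>
              entries P = {1..?l} \<and> entries Q = {1..?l}}"
    unfolding PQ[symmetric]
    by (rule bij_betw_apply[OF bij_robinson_schensted])
      (use matching_perm_permutes[OF matching_free_parts[OF p]] in blast)
  then have "tableau_shape P \<in> int_partitions" "psize (tableau_shape P) = ?l"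
    "standard_tableau (tableau_shape P) P" "standard_tableau (tableau_shape P) Q"
    using shape_in_int_partitions[of P] psize_shape_card[of P] by (auto simp: standard_tableau_iff)
  then show "?f p \<in> ?B" using halves_marked[OF p] by (simp add: bra_ket_wrt_def PQ)
next
  fix y assume "y \<in> ?B"
  then obtain lam \<sigma> P \<tau> Q where y: "y = (lam, ((\<sigma>, P), (\<tau>, Q)))" and lam: "lam \<in> int_partitions"
    and \<sigma>: "\<sigma> \<in> marked_halves x n (psize lam)" and \<tau>: "\<tau> \<in> marked_halves x n (psize lam)"
    and PQ: "tableau P" "tableau_shape P = lam" "entries P = {1..psize lam}"
      "tableau Q" "tableau_shape Q = lam" "entries Q = {1..psize lam}"
    by (auto simp: standard_tableau_iff)
  have "(P, Q) \<in> (\<lambda>\<pi>. robinson_schensted \<pi> (psize lam)) ` {\<pi>. \<pi> permutes {1..psize lam}}"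
    unfolding bij_betw_imp_surj_on[OF bij_robinson_schensted] using PQ by simp
  then obtain \<pi> where \<pi>: "\<pi> permutes {1..psize lam}" "robinson_schensted \<pi> (psize lam) = (P, Q)" by force
  from marked_diagram_exists[OF \<sigma> \<tau> \<pi>(1)] obtain p where p: "p \<in> ?A" "left_half p = \<sigma>"
    "right_half p = \<tau>" "matching_perm (free_parts x p) = \<pi>" "card (free_parts x p) = psize lam" by blast
  then have "y = ?f p" using \<pi>(2) PQ(2) by (simp add: y bra_ket_wrt_def)
  with p(1) show "\<exists>p\<in>?A. y = ?f p" by blast
qed

lemma bij_bra_ket:
  "bij_betw bra_ket (Cp n)
     (SIGMA lam:int_partitions. Yp (2 * n) (Inl lam) \<times> Yp (2 * n) (Inl lam))"
proof -
  have dom: "marked_diagrams (Suc n) n = Cp n" by (simp add: marked_diagrams_def)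
  have eq: "bra_ket_wrt (free_parts (Suc n) p) p = bra_ket p" if "p \<in> Cp n" for p
  proof -
    have "free_parts (Suc n) p = propagating_parts p"
      using CpD(6)[OF that, of _ "Suc n"] by (auto simp: free_parts_def propagating_parts_def)
    then show ?thesis by (simp add: bra_ket_def)
  qed
  have cod: "Yp (2 * n) (Inl lam) = marked_halves (Suc n) n (psize lam) \<times> {T. standard_tableau lam T}"
    for lam
  proof -
    have "{A \<in> snd \<sigma>. Suc n \<notin> A} = snd \<sigma>" if "\<sigma> \<in> half_partitions n" for \<sigma>
      using components_subset[OF that] by force
    then have "marked_halves (Suc n) n l = {\<sigma> \<in> half_partitions n. card (snd \<sigma>) = l}" for l
      by (auto simp: marked_halves_def)
    then show ?thesis by (simp add: Yp_even_def)
  qed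
  show ?thesis
    unfolding cod
    by (rule bij_betw_cong[THEN iffD1, OF eq]) (assumption, rule bij_bra_ket_marked[of "Suc n" n, unfolded dom])
qed

lemma marked_halves_Suc:
  "marked_halves (Suc n) (Suc n) l =
     {\<sigma> \<in> half_partitions (Suc n). card (snd \<sigma>) = Suc l \<and> (\<exists>A\<in>snd \<sigma>. Suc n \<in> A)}"
proof -
  have "card (snd \<sigma>) = Suc (card {A \<in> snd \<sigma>. Suc n \<notin> A})"
    if \<sigma>: "\<sigma> \<in> half_partitions (Suc n)" and A: "A \<in> snd \<sigma>" "Suc n \<in> A" for \<sigma> A
  proof -
    note fam = component_family_half[OF \<sigma>]
    have "snd \<sigma> = insert A {A \<in> snd \<sigma>. Suc n \<notin> A}"
      using component_family_unique[OF fam, of _ A "Suc n"] A by auto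
    moreover have "finite {A \<in> snd \<sigma>. Suc n \<notin> A}" using fam by (simp add: component_family_def)
    ultimately show ?thesis using A(2) card_insert_disjoint by (metis (no_types, lifting) mem_Collect_eq)
  qed
  then show ?thesis by (auto simp: marked_halves_def)
qed

lemma bij_bra_ket_plus:
  "bij_betw (bra_ket_plus n) (Cp_plus n)
     (SIGMA lam:int_partitions. Yp (2 * n + 1) (Inr lam) \<times> Yp (2 * n + 1) (Inr lam))"
proof -
  have "marked_diagrams (Suc n) (Suc n) = Cp_plus n" by (simp add: marked_diagrams_def Cp_plus_def)
  then show ?thesis
    using bij_bra_ket_marked[of "Suc n" "Suc n"]
    by (simp add: Yp_odd_def bra_ket_plus_def[abs_def] free_parts_def marked_halves_Suc)
qed

lemma add_strand_Cp:
  "inj_on (add_strand n) (Cp n)" "add_strand n ` Cp n \<subseteq> Cp_plus n" "Cp_plus n \<subseteq> Cp (n + 1)"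
proof -
  have new: "{Inl (n + 1), Inr (n + 1)} \<notin> p" if "p \<in> Cp n" for p
    using CpD(6)[OF that, of _ "n + 1"] by auto
  show "inj_on (add_strand n) (Cp n)"
    using new by (intro inj_onI) (simp add: add_strand_def insert_ident)
  show "add_strand n ` Cp n \<subseteq> Cp_plus n"
  proof
    fix q assume "q \<in> add_strand n ` Cp n"
    then obtain p where p: "p \<in> Cp n" "q = insert {Inl (n + 1), Inr (n + 1)} p"
      by (auto simp: add_strand_def)
    have U: "\<Union>p = Inl ` {1..n} \<union> Inr ` {1..n}" by (rule CpD(5)[OF p(1)])
    have "Inl ` {1..n+1} \<union> Inr ` {1..n+1} - {Inl (n + 1), Inr (n + 1)} =
          (Inl ` {1..n} \<union> Inr ` {1..n} :: (nat + nat) set)" by auto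
    moreover have "disjnt {Inl (n + 1), Inr (n + 1)} (\<Union>p)" unfolding U by (auto simp: disjnt_def)
    ultimately have "q \<in> Cp (n + 1)"
      using p(1) unfolding p(2) Cp_def mem_Collect_eq by (subst partition_on_insert) auto
    then show "q \<in> Cp_plus n" using p(2) by (simp add: Cp_plus_def)
  qed
  show "Cp_plus n \<subseteq> Cp (n + 1)" by (auto simp: Cp_plus_def)
qed

section \<open>Pascal arrays from bijections\<close>

text \<open>The edge map of \<open>e\<close> is the restriction of the bijection for the head of \<open>e\<close> to the summand indexed by
  \<open>e\<close>: injectivity on each summand and disjointness of the images of different summands are together
  the injectivity of the bijection.\<close>

lemma pascal_arrayI:
  assumes wf: "wf_digraph G" and "v0 \<in> verts G" "is_singleton (Y 0 v0)"
    and "\<And>v. v \<in> verts G \<Longrightarrow> v \<noteq> v0 \<Longrightarrow> Y 0 v = {}"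
    and bij: "\<And>m v. v \<in> verts G \<Longrightarrow>
      \<exists>g. bij_betw g (SIGMA e:{e \<in> arcs G. head G e = v}. Y m (tail G e)) (Y (Suc m) v)"
  shows "pascal_array G v0 Y"
proof -
  define g where "g m v = (SOME g. bij_betw g (SIGMA e:{e \<in> arcs G. head G e = v}. Y m (tail G e))
    (Y (Suc m) v))" for m v
  have g: "bij_betw (g m v) (SIGMA e:{e \<in> arcs G. head G e = v}. Y m (tail G e)) (Y (Suc m) v)"
    if "v \<in> verts G" for m v
    unfolding g_def by (rule someI_ex[OF bij[OF that]])
  define \<phi> where "\<phi> m e y = g (m - 1) (head G e) (e, y)" for m e y
  have "\<forall>m\<ge>1.
          (\<forall>e\<in>arcs G. inj_on (\<phi> m e) (Y (m - 1) (tail G e)) \<and>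
                       \<phi> m e ` Y (m - 1) (tail G e) \<subseteq> Y m (head G e)) \<and>
          (\<forall>v\<in>verts G.
             Y m v = (\<Union>e\<in>{e\<in>arcs G. head G e = v}. \<phi> m e ` Y (m - 1) (tail G e)) \<and>
             disjoint_family_on (\<lambda>e. \<phi> m e ` Y (m - 1) (tail G e)) {e\<in>arcs G. head G e = v})"
  proof (intro allI impI conjI ballI)
    fix m :: nat assume m: "m \<ge> 1"
    {
      fix e assume e: "e \<in> arcs G"
      then have v: "head G e \<in> verts G" using wf by (simp add: wf_digraph.head_in_verts)
      show "inj_on (\<phi> m e) (Y (m - 1) (tail G e))"
        using bij_betw_imp_inj_on[OF g[OF v, of "m - 1"]] e unfolding \<phi>_def inj_on_def by auto
      show "\<phi> m e ` Y (m - 1) (tail G e) \<subseteq> Y m (head G e)"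
        using bij_betwE[OF g[OF v, of "m - 1"]] e m unfolding \<phi>_def by auto
    next
      fix v assume v: "v \<in> verts G"
      show "Y m v = (\<Union>e\<in>{e\<in>arcs G. head G e = v}. \<phi> m e ` Y (m - 1) (tail G e))"
      proof -
        have "Y m v = g (m - 1) v ` (SIGMA e:{e \<in> arcs G. head G e = v}. Y (m - 1) (tail G e))"
          using bij_betw_imp_surj_on[OF g[OF v, of "m - 1"]] m by simp
        also have "\<dots> = (\<Union>e\<in>{e\<in>arcs G. head G e = v}. \<phi> m e ` Y (m - 1) (tail G e))"
          unfolding \<phi>_def Sigma_def by auto
        finally show ?thesis .
      qed
      show "disjoint_family_on (\<lambda>e. \<phi> m e ` Y (m - 1) (tail G e)) {e\<in>arcs G. head G e = v}"
        using bij_betw_imp_inj_on[OF g[OF v, of "m - 1"]]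
        unfolding \<phi>_def disjoint_family_on_def inj_on_def by fastforce
    }
  qed
  with assms show ?thesis unfolding pascal_array_def by blast
qed

text \<open>Passes from edges into a fixed vertex to their tails, which determine them.\<close>

lemma bij_betw_Sigma_reindex:
  assumes h: "inj_on h A" and g: "bij_betw g (SIGMA a:A. B (h a)) T"
  shows "\<exists>g. bij_betw g (SIGMA e:h ` A. B e) T"
proof -
  have "bij_betw (\<lambda>(a, y). (h a, y)) (SIGMA a:A. B (h a)) (SIGMA e:h ` A. B e)"
    using h by (auto simp: bij_betw_def inj_on_def image_iff)
  from bij_betw_trans[OF bij_betw_inv_into[OF this] g] show ?thesis by blast
qed

section \<open>Branching rules for standard tableaux\<close>

lemma double_young_edge_iff: "double_young_edge lam nu \<longleftrightarrow> lam = nu \<or> (\<exists>k. lam = grow nu k)"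
proof -
  have "(\<forall>i. int (lam i) - int (nu i) = (if i = k then 1 else 0)) \<longleftrightarrow> lam = grow nu k" for k
    by (auto simp: grow_def fun_eq_iff split: if_splits)
  then show ?thesis by (simp add: double_young_edge_def)
qed

lemma psize_grow:
  assumes "nu \<in> int_partitions"
  shows "psize (grow nu k) = Suc (psize nu)"
proof -
  let ?A = "insert k {i. nu i \<noteq> 0}"
  have fin: "finite ?A" using assms by (simp add: int_partitions_def)
  have "psize (grow nu k) = sum (grow nu k) ?A"
    by (rule psize_eq_sum[OF fin]) (auto simp: grow_def)
  also have "\<dots> = Suc (sum nu ?A)"
  proof -
    have "grow nu k = (\<lambda>i. nu i + (if i = k then 1 else 0))" by (auto simp: grow_def)
    then show ?thesis using fin by (simp only: sum.distrib sum.delta) simp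
  qed
  also have "sum nu ?A = psize nu" by (rule psize_eq_sum[OF fin, symmetric]) auto
  finally show ?thesis .
qed

definition standard_tableaux :: "(nat \<Rightarrow> nat) \<Rightarrow> tableau set" where
  "standard_tableaux lam = {T. standard_tableau lam T}"

lemma standard_tableaux_iff:
  "lam \<in> int_partitions \<Longrightarrow>
     T \<in> standard_tableaux lam \<longleftrightarrow> tableau T \<and> tableau_shape T = lam \<and> entries T = {1..psize lam}"
  by (simp add: standard_tableaux_def standard_tableau_iff)

definition lower :: "(nat \<Rightarrow> nat) \<Rightarrow> (nat \<Rightarrow> nat) set" where
  "lower lam = {nu \<in> int_partitions. \<exists>k. lam = grow nu k}"

definition upper :: "(nat \<Rightarrow> nat) \<Rightarrow> (nat \<Rightarrow> nat) set" where
  "upper nu = {lam \<in> int_partitions. \<exists>k. lam = grow nu k}"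

text \<open>Removing the largest entry. For the empty shape the left side is empty and the right side is not, which
  is why the size has to be positive.\<close>

lemma branching_down:
  assumes lam: "lam \<in> int_partitions" and size: "psize lam = Suc l"
  shows "\<exists>b. bij_betw b (SIGMA nu:lower lam. standard_tableaux nu) (standard_tableaux lam)"
proof -
  define row where "row nu = (THE k. lam = grow nu k)" for nu
  have row: "row nu = k" if "lam = grow nu k" for nu k
    unfolding row_def by (rule the_equality) (use that in auto)
  have anti: "antimono lam" using lam by (simp add: int_partitions_def)
  have l: "psize nu = l" if "nu \<in> lower lam" for nu
    using that psize_grow size by (auto simp: lower_def)
  have st: "T \<in> standard_tableaux nu \<longleftrightarrow> tableau T \<and> tableau_shape T = nu \<and> entries T = {1..l}"
    if "nu \<in> lower lam" for nu T
    using that l[OF that] by (simp add: standard_tableaux_iff lower_def)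
  have le: "row nu \<le> length T" and gr: "lam = grow nu (row nu)"
    if "nu \<in> lower lam" "T \<in> standard_tableaux nu" for nu T
    using that row anti st by (auto simp: lower_def intro!: grow_row_le_length)
  have "bij_betw (\<lambda>(nu, T). add_box (row nu) (Suc l) T)
    (SIGMA nu:lower lam. standard_tableaux nu) (standard_tableaux lam)"
  proof (rule bij_betwI')
    fix x y assume "x \<in> (SIGMA nu:lower lam. standard_tableaux nu)"
      "y \<in> (SIGMA nu:lower lam. standard_tableaux nu)"
    then obtain nu T mu S where xy: "x = (nu, T)" "y = (mu, S)" and in_lower: "nu \<in> lower lam" "mu \<in> lower lam"
      and TS: "T \<in> standard_tableaux nu" "S \<in> standard_tableaux mu" by blast
    have "nu = mu \<and> T = S" if "add_box (row nu) (Suc l) T = add_box (row mu) (Suc l) S"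
      using add_box_inj[of T S "Suc l" "row nu" "row mu"] that le[OF in_lower(1) TS(1)] le[OF in_lower(2) TS(2)]
        TS in_lower by (auto simp: st)
    then show "((case x of (nu, T) \<Rightarrow> add_box (row nu) (Suc l) T) =
      (case y of (nu, T) \<Rightarrow> add_box (row nu) (Suc l) T)) = (x = y)"
      unfolding xy by auto
  next
    fix x assume "x \<in> (SIGMA nu:lower lam. standard_tableaux nu)"
    then obtain nu T where x: "x = (nu, T)" and in_lower: "nu \<in> lower lam"
      and T: "T \<in> standard_tableaux nu" by blast
    note gr = gr[OF in_lower T] and le = le[OF in_lower T]
    have "tableau (add_box (row nu) (Suc l) T)"
      using T in_lower gr anti by (intro tableau_add_box) (auto simp: st)
    moreover have "tableau_shape (add_box (row nu) (Suc l) T) = lam"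
      using T in_lower gr le by (simp add: shape_add_box st)
    moreover have "entries (add_box (row nu) (Suc l) T) = {1..Suc l}"
      using T in_lower by (simp add: entries_add_box st atLeastAtMostSuc_conv)
    ultimately show "(case x of (nu, T) \<Rightarrow> add_box (row nu) (Suc l) T) \<in> standard_tableaux lam"
      unfolding x by (simp add: standard_tableaux_iff[OF lam] size)
  next
    fix T assume "T \<in> standard_tableaux lam"
    then have T: "tableau T" "tableau_shape T = lam" "entries T = {1..Suc l}"
      by (auto simp: standard_tableaux_iff[OF lam] size)
    then have "\<exists>k Q. tableau Q \<and> k \<le> length Q \<and> T = add_box k (Suc l) Q \<and> entries Q = entries T - {Suc l}"
      by (intro remove_max_box) auto
    then obtain k Q where Q: "tableau Q" "k \<le> length Q" "T = add_box k (Suc l) Q" "entries Q = {1..l}"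
      unfolding T(3) by (auto simp: atLeastAtMostSuc_conv)
    define nu where "nu = tableau_shape Q"
    have "lam = grow nu k" using T(2) Q by (simp add: nu_def shape_add_box)
    moreover from this have "nu \<in> lower lam"
      using shape_in_int_partitions[OF Q(1)] by (auto simp: lower_def nu_def)
    moreover from this have "Q \<in> standard_tableaux nu" using Q by (simp add: st nu_def)
    ultimately show "\<exists>x\<in>SIGMA nu:lower lam. standard_tableaux nu.
        T = (case x of (nu, T) \<Rightarrow> add_box (row nu) (Suc l) T)"
      using Q(3) row by (intro bexI[of _ "(nu, Q)"]) auto
  qed
  then show ?thesis by blast
qed

text \<open>Only the relative order of the entries matters.\<close>

lemma map_tableau:
  assumes "tableau T" "strict_mono_on (entries T) f"
  shows "tableau (map (map f) T)"
  using assms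
proof (induction T)
  case (Cons r rs)
  have mono: "f a < f b" if "a \<in> set r \<union> entries rs" "b \<in> set r \<union> entries rs" "a < b" for a b
    using Cons.prems(2) that by (auto simp: strict_mono_on_def)
  have r: "r \<noteq> []" "sorted_wrt (<) r" "above r (first_row rs)" "set r \<inter> entries rs = {}" "tableau rs"
    using Cons.prems(1) by auto
  have "tableau (map (map f) rs)"
    by (rule Cons.IH[OF r(5)]) (use mono in \<open>auto simp: strict_mono_on_def\<close>)
  moreover have "sorted_wrt (<) (map f r)"
    using r(2) mono by (auto simp: sorted_wrt_map intro: sorted_wrt_mono_rel[rotated])
  moreover have "above (map f r) (first_row (map (map f) rs))"
  proof (cases rs)
    case (Cons s ss)
    then show ?thesis using r(3) mono by (auto simp: above_def)
  qed (simp add: above_def)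
  moreover have "set (map f r) \<inter> entries (map (map f) rs) = {}"
  proof -
    have "entries (map (map f) rs) = f ` entries rs" by (auto simp: entries_def)
    moreover have "f a \<noteq> f b" if "a \<in> set r" "b \<in> entries rs" for a b
      using mono[of a b] mono[of b a] that r(4) by (metis IntI UnI1 UnI2 empty_iff linorder_neqE_nat order.irrefl)
    ultimately show ?thesis by auto
  qed
  ultimately show ?case using r(1) by simp
qed simp

lemma entries_map: "entries (map (map f) T) = f ` entries T"
  by (auto simp: entries_def)

lemma shape_map: "tableau_shape (map (map f) T) = tableau_shape T"
  by (auto simp: tableau_shape_def fun_eq_iff)

text \<open>The increasing enumeration of all numbers except \<open>x\<close>.\<close>

definition skip :: "nat \<Rightarrow> nat \<Rightarrow> nat" where
  "skip x i = (if i < x then i else Suc i)"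

definition unskip :: "nat \<Rightarrow> nat \<Rightarrow> nat" where
  "unskip x i = (if i < x then i else i - 1)"

lemma unskip_skip [simp]: "unskip x (skip x i) = i"
  by (auto simp: skip_def unskip_def)

lemma skip_unskip: "i \<noteq> x \<Longrightarrow> skip x (unskip x i) = i"
  by (auto simp: skip_def unskip_def)

lemma unskip_less: "i < j \<Longrightarrow> i \<noteq> x \<Longrightarrow> j \<noteq> x \<Longrightarrow> unskip x i < unskip x j"
  unfolding unskip_def by auto

lemma skip_image: "x \<in> {1..Suc l} \<Longrightarrow> skip x ` {1..l} = {1..Suc l} - {x}"
proof (intro equalityI subsetI)
  fix i assume x: "x \<in> {1..Suc l}" and i: "i \<in> {1..Suc l} - {x}"
  then have "unskip x i \<in> {1..l}" by (auto simp: unskip_def)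
  then show "i \<in> skip x ` {1..l}" using skip_unskip[of i x] i by (metis DiffE image_eqI singletonI)
qed (auto simp: skip_def split: if_splits)

text \<open>Inserting \<open>x\<close> into a standard tableau whose entries from \<open>x\<close> on have been raised by one: the entries are
  then again \<open>1, \<dots>, l + 1\<close>, and reversibility of insertion makes this a bijection.\<close>

lemma branching_up:
  assumes nu: "nu \<in> int_partitions" and size: "psize nu = l"
  shows "\<exists>b. bij_betw b (SIGMA lam:upper nu. standard_tableaux lam) ({1..Suc l} \<times> standard_tableaux nu)"
proof -
  define ins where "ins x T = tableau_insert x (map (map (skip x)) T)" for x T
  have st: "T \<in> standard_tableaux nu \<longleftrightarrow> tableau T \<and> tableau_shape T = nu \<and> entries T = {1..l}" for T
    using standard_tableaux_iff[OF nu] size by simp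
  have st': "T \<in> standard_tableaux lam \<longleftrightarrow> tableau T \<and> tableau_shape T = lam \<and> entries T = {1..Suc l}"
    if "lam \<in> upper nu" for lam T
    using that size psize_grow[OF nu] by (auto simp: standard_tableaux_iff upper_def)
  have relabel: "tableau (map (map (skip x)) T)" "tableau_shape (map (map (skip x)) T) = nu"
    "entries (map (map (skip x)) T) = {1..Suc l} - {x}"
    if "x \<in> {1..Suc l}" "T \<in> standard_tableaux nu" for x T
  proof -
    have T: "tableau T" "tableau_shape T = nu" "entries T = {1..l}" using that(2) by (simp_all add: st)
    show "tableau (map (map (skip x)) T)"
      by (rule map_tableau[OF T(1)]) (auto simp: strict_mono_on_def skip_def)
    show "tableau_shape (map (map (skip x)) T) = nu" using T(2) by (simp add: shape_map)
    show "entries (map (map (skip x)) T) = {1..Suc l} - {x}"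
      unfolding entries_map T(3) by (rule skip_image[OF that(1)])
  qed
  have "bij_betw (\<lambda>(x, T). (tableau_shape (ins x T), ins x T))
     ({1..Suc l} \<times> standard_tableaux nu) (SIGMA lam:upper nu. standard_tableaux lam)"
  proof (rule bij_betwI')
    fix a b assume "a \<in> {1..Suc l} \<times> standard_tableaux nu" "b \<in> {1..Suc l} \<times> standard_tableaux nu"
    then obtain x T y S where ab: "a = (x, T)" "b = (y, S)" and xy: "x \<in> {1..Suc l}" "y \<in> {1..Suc l}"
      and TS: "T \<in> standard_tableaux nu" "S \<in> standard_tableaux nu" by blast
    have "x = y \<and> T = S" if "ins x T = ins y S"
    proof -
      have eq: "x = y \<and> map (map (skip x)) T = map (map (skip y)) S"
        using that relabel xy TS unfolding ins_def by (intro tableau_insert_inj) auto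
      have inj: "inj (map (map (skip y)))"
        by (intro inj_mapI inj_on_inverseI[where g = "unskip y"]) simp
      then have "T = S" using eq injD[OF inj, of T S] by metis
      with eq show ?thesis by blast
    qed
    then show "((case a of (x, T) \<Rightarrow> (tableau_shape (ins x T), ins x T)) =
        (case b of (x, T) \<Rightarrow> (tableau_shape (ins x T), ins x T))) = (a = b)"
      unfolding ab by auto
  next
    fix a assume "a \<in> {1..Suc l} \<times> standard_tableaux nu"
    then obtain x T where a: "a = (x, T)" and x: "x \<in> {1..Suc l}" and T: "T \<in> standard_tableaux nu" by blast
    have tab: "tableau (ins x T)" unfolding ins_def
      by (rule tableau_tableau_insert) (use relabel[OF x T] in auto)
    moreover obtain k where "tableau_shape (ins x T) = grow nu k"
      unfolding ins_def using shape_tableau_insert relabel(2)[OF x T] by metis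
    ultimately have "tableau_shape (ins x T) \<in> upper nu"
      using shape_in_int_partitions[OF tab] by (auto simp: upper_def)
    moreover have "entries (ins x T) = {1..Suc l}"
      unfolding ins_def entries_tableau_insert relabel(3)[OF x T] using x by auto
    ultimately show "(case a of (x, T) \<Rightarrow> (tableau_shape (ins x T), ins x T))
        \<in> (SIGMA lam:upper nu. standard_tableaux lam)"
      using tab by (simp add: a st')
  next
    fix b assume "b \<in> (SIGMA lam:upper nu. standard_tableaux lam)"
    then obtain lam T where b: "b = (lam, T)" and lam: "lam \<in> upper nu"
      and T: "tableau T" "tableau_shape T = lam" "entries T = {1..Suc l}" using st' by blast
    obtain k where "lam = grow nu k" using lam by (auto simp: upper_def)
    then obtain P x where P: "tableau P" "tableau_shape P = nu" "x \<notin> entries P" "tableau_insert x P = T"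
      using tableau_insert_surj[OF T(1), of nu k] nu T(2) by (auto simp: int_partitions_def)
    have ins: "insert x (entries P) = {1..Suc l}"
      using entries_tableau_insert[of x P] P(4) T(3) by simp
    then have x: "x \<in> {1..Suc l}" and eP: "entries P = {1..Suc l} - {x}" using P(3) by auto
    define S where "S = map (map (unskip x)) P"
    have "map (map (skip x)) S = P"
      unfolding S_def map_map comp_def
      by (rule map_idI, rule map_idI) (use P(3) in \<open>auto simp: entries_def intro!: skip_unskip\<close>)
    then have "ins x S = T" using P(4) by (simp add: ins_def)
    moreover have "entries S = {1..l}"
    proof -
      have "entries S = unskip x ` skip x ` {1..l}"
        unfolding S_def entries_map skip_image[OF x] eP ..
      then show ?thesis by (simp add: image_image)
    qed
    moreover have "strict_mono_on (entries P) (unskip x)"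
    proof (rule strict_mono_onI)
      fix i j assume "i \<in> entries P" "j \<in> entries P" "i < j"
      then show "unskip x i < unskip x j" using P(3) by (intro unskip_less) auto
    qed
    then have "tableau S" unfolding S_def by (rule map_tableau[OF P(1)])
    ultimately show "\<exists>a\<in>{1..Suc l} \<times> standard_tableaux nu.
        b = (case a of (x, T) \<Rightarrow> (tableau_shape (ins x T), ins x T))"
      using x P(2) T(2) b by (intro bexI[of _ "(x, S)"]) (auto simp: st S_def shape_map)
  qed
  from bij_betw_inv_into[OF this] show ?thesis by blast
qed

section \<open>Half-partitions along the edges\<close>

text \<open>The half-partitions with \<open>l + 1\<close> propagating components, one of which contains \<open>n + 1\<close>
  (\<open>marked_halves_Suc\<close>).\<close>

abbreviation rooted_halves :: "nat \<Rightarrow> nat \<Rightarrow> half_partition set" where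
  "rooted_halves n l \<equiv> marked_halves (Suc n) (Suc n) l"

abbreviation halves_of_rank :: "nat \<Rightarrow> nat \<Rightarrow> half_partition set" where
  "halves_of_rank n l \<equiv> {\<sigma> \<in> half_partitions n. card (snd \<sigma>) = l}"

lemma Yp_odd_eq: "Yp_odd n nu = rooted_halves n (psize nu) \<times> standard_tableaux nu"
  by (simp add: Yp_odd_def marked_halves_Suc standard_tableaux_def)

lemma Yp_even_eq: "Yp_even n lam = halves_of_rank n (psize lam) \<times> standard_tableaux lam"
  by (simp add: Yp_even_def standard_tableaux_def)

lemma partition_on_replace:
  assumes P: "partition_on X P" and A: "A \<in> P" and B: "B \<noteq> {}" "B \<inter> (X - A) = {}"
  shows "partition_on ((X - A) \<union> B) (insert B (P - {A}))"
proof -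
  have "disjnt A (\<Union>(P - {A}))"
    using partition_onD2[OF P] A by (auto simp: disjoint_def disjnt_def)
  then have rest: "partition_on (X - A) (P - {A})"
    using partition_on_insert[of A "P - {A}" X] P A by (simp add: insert_absorb)
  then have "disjnt B (\<Union>(P - {A}))"
    using B(2) partition_onD1[OF rest] by (simp add: disjnt_def)
  moreover have "(X - A) \<union> B - B = X - A" using B(2) by blast
  ultimately show ?thesis using partition_on_insert[of B "P - {A}"] rest B(1) by simp
qed

text \<open>The component of \<open>x\<close> stops propagating.\<close>

definition cut :: "nat \<Rightarrow> half_partition \<Rightarrow> half_partition" where
  "cut x \<sigma> = (fst \<sigma> \<union> {A \<in> snd \<sigma>. x \<in> A}, {A \<in> snd \<sigma>. x \<notin> A})"

definition uncut :: "nat \<Rightarrow> half_partition \<Rightarrow> half_partition" where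
  "uncut x \<sigma> = ({A \<in> fst \<sigma>. x \<notin> A}, snd \<sigma> \<union> {A \<in> fst \<sigma>. x \<in> A})"

text \<open>The part of \<open>n + 1\<close> can be returned to the propagating components, so cutting loses nothing.\<close>

lemma bij_cut:
  "bij_betw (cut (Suc n)) (rooted_halves n l)
     {\<sigma> \<in> halves_of_rank (Suc n) l. \<forall>A\<in>snd \<sigma>. Suc n \<notin> A}"
proof (rule bij_betw_byWitness[where f' = "uncut (Suc n)"])
  let ?A = "rooted_halves n l" and ?B = "{\<sigma> \<in> halves_of_rank (Suc n) l. \<forall>A\<in>snd \<sigma>. Suc n \<notin> A}"
  have "\<forall>B\<in>fst \<sigma>. Suc n \<notin> B" if \<sigma>: "\<sigma> \<in> ?A" for \<sigma>
  proof
    fix B assume B: "B \<in> fst \<sigma>"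
    have h: "\<sigma> \<in> half_partitions (Suc n)" using \<sigma> by (simp add: marked_halves_def)
    obtain A where A: "A \<in> snd \<sigma>" "Suc n \<in> A" using \<sigma> by (auto simp: marked_halves_def)
    show "Suc n \<notin> B"
      using component_family_unique[OF component_family_half[OF h], of A B "Suc n"] A B h
      by (auto simp: half_partitions_iff)
  qed
  then show "\<forall>\<sigma>\<in>?A. uncut (Suc n) (cut (Suc n) \<sigma>) = \<sigma>"
    by (auto simp: cut_def uncut_def prod_eq_iff)
  show "\<forall>\<sigma>\<in>?B. cut (Suc n) (uncut (Suc n) \<sigma>) = \<sigma>"
    by (auto simp: cut_def uncut_def prod_eq_iff)
  have un: "fst (cut (Suc n) \<sigma>) \<union> snd (cut (Suc n) \<sigma>) = fst \<sigma> \<union> snd \<sigma>"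
    "fst (uncut (Suc n) \<sigma>) \<union> snd (uncut (Suc n) \<sigma>) = fst \<sigma> \<union> snd \<sigma>" for \<sigma>
    by (auto simp: cut_def uncut_def)
  have half: "cut (Suc n) \<sigma> \<in> half_partitions (Suc n)" "uncut (Suc n) \<sigma> \<in> half_partitions (Suc n)"
    if "\<sigma> \<in> half_partitions (Suc n)" for \<sigma>
    using that unfolding half_partitions_iff un by (auto simp: cut_def uncut_def)
  show "cut (Suc n) ` ?A \<subseteq> ?B"
    using half(1) by (auto simp: marked_halves_def cut_def)
  show "uncut (Suc n) ` ?B \<subseteq> ?A"
  proof
    fix \<tau> assume "\<tau> \<in> uncut (Suc n) ` ?B"
    then obtain \<sigma> where \<sigma>: "\<sigma> \<in> half_partitions (Suc n)" "card (snd \<sigma>) = l" "\<forall>A\<in>snd \<sigma>. Suc n \<notin> A"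
      and \<tau>: "\<tau> = uncut (Suc n) \<sigma>" by auto
    have P: "partition_on {1..Suc n} (fst \<sigma> \<union> snd \<sigma>)" using \<sigma>(1) by (simp add: half_partitions_iff)
    have "Suc n \<in> \<Union>(fst \<sigma> \<union> snd \<sigma>)" unfolding partition_onD1[OF P, symmetric] by simp
    then have "\<exists>A\<in>snd \<tau>. Suc n \<in> A" using \<sigma>(3) by (auto simp: \<tau> uncut_def)
    moreover have "{A \<in> snd \<tau>. Suc n \<notin> A} = snd \<sigma>" using \<sigma>(3) by (auto simp: \<tau> uncut_def)
    ultimately show "\<tau> \<in> ?A" using half(2)[OF \<sigma>(1)] \<sigma>(2) by (simp add: marked_halves_def \<tau>)
  qed
qed

lemma bij_betw_Sigma_swap:
  "bij_betw (\<lambda>(a, x, y). (x, a, y)) (SIGMA a:A. X \<times> Y a) (X \<times> (SIGMA a:A. Y a))"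
  by (rule bij_betw_byWitness[where f' = "\<lambda>(x, a, y). (a, x, y)"]) auto

section \<open>The Pascal array\<close>

text \<open>The edge that keeps the shape yields the half-partitions where \<open>n + 1\<close> does not propagate; the edges
  that add a box yield those where it does, their components being counted by the larger shape.\<close>

lemma even_step:
  assumes lam: "lam \<in> int_partitions"
  shows "\<exists>g. bij_betw g (SIGMA nu:insert lam (lower lam). Yp_odd n nu) (Yp_even (Suc n) lam)"
proof -
  have size: "Suc (psize nu) = psize lam" if "nu \<in> lower lam" for nu
    using that psize_grow by (auto simp: lower_def)
  have neq: "nu \<noteq> lam" if "nu \<in> lower lam" for nu using size[OF that] by auto
  let ?H = "halves_of_rank (Suc n) (psize lam)"
  let ?D = "{\<sigma> \<in> ?H. \<forall>A\<in>snd \<sigma>. Suc n \<notin> A}" and ?E = "{\<sigma> \<in> ?H. \<exists>A\<in>snd \<sigma>. Suc n \<in> A}"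
  have rooted: "rooted_halves n (psize nu) = ?E" if "nu \<in> lower lam" for nu
    unfolding marked_halves_Suc size[OF that] by auto
  obtain b where b: "bij_betw (map_prod id b) (?E \<times> (SIGMA nu:lower lam. standard_tableaux nu))
      (?E \<times> standard_tableaux lam)"
  proof (cases "psize lam")
    case 0
    have "\<not> (\<exists>A\<in>snd \<sigma>. Suc n \<in> A)" if "\<sigma> \<in> ?H" for \<sigma>
    proof -
      have "finite (snd \<sigma>)" "card (snd \<sigma>) = 0"
        using component_family_half[of \<sigma> "Suc n"] that 0 by (simp_all add: component_family_def)
      then show ?thesis by simp
    qed
    then have E: "?E = {}" by blast
    show ?thesis by (rule that, unfold E) (simp add: bij_betw_def)
  next
    case (Suc l)
    then show ?thesis using branching_down[OF lam Suc] that bij_betw_map_prod[OF bij_betw_id] by blast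
  qed
  define g where "g = (\<lambda>(nu, \<sigma>, T). if nu = lam then (cut (Suc n) \<sigma>, T) else (\<sigma>, b (nu, T)))"
  have 1: "bij_betw g (SIGMA nu:{lam}. Yp_odd n nu) (?D \<times> standard_tableaux lam)"
  proof -
    have "bij_betw snd (SIGMA nu:{lam}. Yp_odd n nu)
        (rooted_halves n (psize lam) \<times> standard_tableaux lam)"
      by (auto simp: bij_betw_def inj_on_def Yp_odd_eq image_iff)
    from bij_betw_trans[OF this bij_betw_map_prod[OF bij_cut bij_betw_id]] show ?thesis
      by (rule bij_betw_cong[THEN iffD1, rotated]) (auto simp: g_def)
  qed
  have 2: "bij_betw g (SIGMA nu:lower lam. Yp_odd n nu) (?E \<times> standard_tableaux lam)"
  proof -
    have "(SIGMA nu:lower lam. Yp_odd n nu) = (SIGMA nu:lower lam. ?E \<times> standard_tableaux nu)"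
      by (rule Sigma_cong) (simp_all only: Yp_odd_eq rooted)
    with bij_betw_trans[OF bij_betw_Sigma_swap b]
    have "bij_betw (map_prod id b \<circ> (\<lambda>(nu, \<sigma>, T). (\<sigma>, nu, T)))
        (SIGMA nu:lower lam. Yp_odd n nu) (?E \<times> standard_tableaux lam)" by simp
    then show ?thesis by (rule bij_betw_cong[THEN iffD1, rotated]) (use neq in \<open>auto simp: g_def\<close>)
  qed
  have "bij_betw g ((SIGMA nu:{lam}. Yp_odd n nu) \<union> (SIGMA nu:lower lam. Yp_odd n nu))
      (?D \<times> standard_tableaux lam \<union> ?E \<times> standard_tableaux lam)"
    by (rule bij_betw_combine[OF 1 2]) auto
  moreover have "(SIGMA nu:{lam}. Yp_odd n nu) \<union> (SIGMA nu:lower lam. Yp_odd n nu) =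
      (SIGMA nu:insert lam (lower lam). Yp_odd n nu)" by auto
  moreover have "?D \<times> standard_tableaux lam \<union> ?E \<times> standard_tableaux lam = Yp_even (Suc n) lam"
    unfolding Yp_even_eq by blast
  ultimately show ?thesis by metis
qed

text \<open>The half-partitions in which \<open>n + 1\<close> is alone, obtained by adding it as a component.\<close>

lemma bij_new_root:
  "bij_betw (\<lambda>\<tau>. (fst \<tau>, insert {Suc n} (snd \<tau>))) (halves_of_rank n l)
     {\<sigma> \<in> rooted_halves n l. {Suc n} \<in> snd \<sigma>}"
proof (rule bij_betw_byWitness[where f' = "\<lambda>\<sigma>. (fst \<sigma>, snd \<sigma> - {{Suc n}})"])
  let ?f = "\<lambda>\<tau>. (fst \<tau>, insert {Suc n} (snd \<tau>))" and ?g = "\<lambda>\<sigma>. (fst \<sigma>, snd \<sigma> - {{Suc n}})"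
  have Suc: "{1..Suc n} - {Suc n} = {1..n}" by auto
  have f: "?f \<tau> \<in> half_partitions (Suc n) \<and> card (insert {Suc n} (snd \<tau>)) = Suc (card (snd \<tau>)) \<and>
      {Suc n} \<notin> snd \<tau>" if \<tau>: "\<tau> \<in> half_partitions n" for \<tau>
  proof -
    have P: "partition_on {1..n} (fst \<tau> \<union> snd \<tau>)" "fst \<tau> \<inter> snd \<tau> = {}"
      using \<tau> by (simp_all add: half_partitions_iff)
    have new: "{Suc n} \<notin> fst \<tau> \<union> snd \<tau>"
    proof
      assume "{Suc n} \<in> fst \<tau> \<union> snd \<tau>"
      then have "Suc n \<in> \<Union>(fst \<tau> \<union> snd \<tau>)" by (rule UnionI) simp
      then show False unfolding partition_onD1[OF P(1), symmetric] by simp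
    qed
    have "disjnt {Suc n} (\<Union>(fst \<tau> \<union> snd \<tau>))"
      unfolding partition_onD1[OF P(1), symmetric] by simp
    then have "partition_on {1..Suc n} (insert {Suc n} (fst \<tau> \<union> snd \<tau>))"
      using P(1) Suc by (subst partition_on_insert) simp_all
    moreover have "finite (snd \<tau>)"
      using component_family_half[OF \<tau>] by (simp add: component_family_def)
    ultimately show ?thesis using new P(2) by (simp add: half_partitions_iff)
  qed
  have g: "?g \<sigma> \<in> half_partitions n \<and> card (snd \<sigma>) = Suc (card (snd \<sigma> - {{Suc n}}))"
    if \<sigma>: "\<sigma> \<in> half_partitions (Suc n)" and x: "{Suc n} \<in> snd \<sigma>" for \<sigma>
  proof -
    have P: "partition_on {1..Suc n} (fst \<sigma> \<union> snd \<sigma>)" "fst \<sigma> \<inter> snd \<sigma> = {}"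
      using \<sigma> by (simp_all add: half_partitions_iff)
    have split: "fst \<sigma> \<union> snd \<sigma> = insert {Suc n} (fst \<sigma> \<union> (snd \<sigma> - {{Suc n}}))" using x by auto
    have "disjnt {Suc n} (\<Union>(fst \<sigma> \<union> (snd \<sigma> - {{Suc n}})))"
    proof -
      have "Suc n \<notin> C" if "C \<in> fst \<sigma> \<union> (snd \<sigma> - {{Suc n}})" for C
        using component_family_unique[OF component_family_half[OF \<sigma>], of "{Suc n}" C "Suc n"]
          that x P(2) by blast
      then show ?thesis by (auto simp: disjnt_def)
    qed
    then have "partition_on {1..n} (fst \<sigma> \<union> (snd \<sigma> - {{Suc n}}))"
      using P(1) Suc unfolding split by (subst (asm) partition_on_insert) simp_all
    then have "?g \<sigma> \<in> half_partitions n" using P(2) by (auto simp: half_partitions_iff)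
    moreover have "finite (snd \<sigma>)"
      using component_family_half[OF \<sigma>] by (simp add: component_family_def)
    ultimately show ?thesis using card.remove[OF _ x] by simp
  qed
  show "\<forall>\<tau>\<in>halves_of_rank n l. ?g (?f \<tau>) = \<tau>" using f by (auto simp: prod_eq_iff)
  show "\<forall>\<sigma>\<in>{\<sigma> \<in> rooted_halves n l. {Suc n} \<in> snd \<sigma>}. ?f (?g \<sigma>) = \<sigma>" by (auto simp: prod_eq_iff)
  show "?f ` halves_of_rank n l \<subseteq> {\<sigma> \<in> rooted_halves n l. {Suc n} \<in> snd \<sigma>}"
    using f by (auto simp: marked_halves_Suc)
  show "?g ` {\<sigma> \<in> rooted_halves n l. {Suc n} \<in> snd \<sigma>} \<subseteq> halves_of_rank n l"
    using g by (auto simp: marked_halves_Suc)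
qed

lemma replace_component:
  assumes \<sigma>: "\<sigma> \<in> half_partitions n" and A: "A \<in> snd \<sigma>" and B: "B \<noteq> {}" "B \<inter> ({1..n} - A) = {}"
    and X: "({1..n} - A) \<union> B = {1..m}"
  shows "(fst \<sigma>, insert B (snd \<sigma> - {A})) \<in> half_partitions m"
    and "card (insert B (snd \<sigma> - {A})) = card (snd \<sigma>)"
    and "B \<notin> snd \<sigma> - {A}"
proof -
  have P: "partition_on {1..n} (fst \<sigma> \<union> snd \<sigma>)" and i: "fst \<sigma> \<inter> snd \<sigma> = {}"
    using \<sigma> by (simp_all add: half_partitions_iff)
  have "C \<subseteq> {1..n} - A" if "C \<in> fst \<sigma> \<union> snd \<sigma>" "C \<noteq> A" for C
    using partition_onD1[OF P] partition_onD2[OF P] that A by (auto simp: disjoint_def)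
  then have new: "B \<notin> (fst \<sigma> \<union> snd \<sigma>) - {A}" using B by blast
  then show "B \<notin> snd \<sigma> - {A}" by blast
  have "insert B ((fst \<sigma> \<union> snd \<sigma>) - {A}) = fst \<sigma> \<union> insert B (snd \<sigma> - {A})" using i A by blast
  then have "partition_on {1..m} (fst \<sigma> \<union> insert B (snd \<sigma> - {A}))"
    using partition_on_replace[OF P _ B] A X by simp
  then show "(fst \<sigma>, insert B (snd \<sigma> - {A})) \<in> half_partitions m"
    using new i A by (auto simp: half_partitions_iff)
  have "finite (snd \<sigma>)" using component_family_half[OF \<sigma>] by (simp add: component_family_def)
  then show "card (insert B (snd \<sigma> - {A})) = card (snd \<sigma>)"
    using \<open>B \<notin> snd \<sigma> - {A}\<close> card.remove[OF _ A] by simp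
qed

definition attach :: "nat \<Rightarrow> half_partition \<Rightarrow> nat set \<Rightarrow> half_partition" where
  "attach x \<tau> A = (fst \<tau>, insert (insert x A) (snd \<tau> - {A}))"

text \<open>The half-partitions in which \<open>n + 1\<close> is not alone, obtained by letting it join the component \<open>A\<close>; deleting
  \<open>n + 1\<close> recovers \<open>A\<close> as well.\<close>

lemma bij_attach:
  "bij_betw (\<lambda>(\<tau>, A). attach (Suc n) \<tau> A) (SIGMA \<tau>:halves_of_rank n (Suc l). snd \<tau>)
     {\<sigma> \<in> rooted_halves n l. {Suc n} \<notin> snd \<sigma>}"
proof (rule bij_betwI')
  fix a b assume "a \<in> (SIGMA \<tau>:halves_of_rank n (Suc l). snd \<tau>)" "b \<in> (SIGMA \<tau>:halves_of_rank n (Suc l). snd \<tau>)"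
  then obtain \<tau> A \<rho> B where ab: "a = (\<tau>, A)" "b = (\<rho>, B)"
    and \<tau>: "\<tau> \<in> half_partitions n" "A \<in> snd \<tau>" and \<rho>: "\<rho> \<in> half_partitions n" "B \<in> snd \<rho>" by auto
  have no: "Suc n \<notin> C" if "C \<in> snd \<tau> \<union> snd \<rho>" for C
    using components_subset[OF \<tau>(1)] components_subset[OF \<rho>(1)] that by fastforce
  have "\<tau> = \<rho> \<and> A = B" if "attach (Suc n) \<tau> A = attach (Suc n) \<rho> B"
  proof -
    have N: "fst \<tau> = fst \<rho>"
      and C: "insert (insert (Suc n) A) (snd \<tau> - {A}) = insert (insert (Suc n) B) (snd \<rho> - {B})"
      using that by (auto simp: attach_def)
    have new: "insert (Suc n) A \<notin> snd \<tau> \<union> snd \<rho>" "insert (Suc n) B \<notin> snd \<tau> \<union> snd \<rho>"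
      using no[of "insert (Suc n) A"] no[of "insert (Suc n) B"] by auto
    then have "insert (Suc n) A = insert (Suc n) B" using C by blast
    then have AB: "A = B" using no[of A] no[of B] \<tau>(2) \<rho>(2) by (simp add: insert_ident)
    then have "snd \<tau> - {A} = snd \<rho> - {A}" using C new by (auto simp: insert_ident)
    then have "snd \<tau> = snd \<rho>" using AB \<tau>(2) \<rho>(2) by blast
    with N AB show ?thesis by (simp add: prod_eq_iff)
  qed
  then show "((case a of (\<tau>, A) \<Rightarrow> attach (Suc n) \<tau> A) = (case b of (\<tau>, A) \<Rightarrow> attach (Suc n) \<tau> A)) = (a = b)"
    unfolding ab by auto
next
  fix a assume "a \<in> (SIGMA \<tau>:halves_of_rank n (Suc l). snd \<tau>)"
  then obtain \<tau> A where a: "a = (\<tau>, A)" and \<tau>: "\<tau> \<in> half_partitions n" "card (snd \<tau>) = Suc l"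
    and A: "A \<in> snd \<tau>" by auto
  have sub: "C \<subseteq> {1..n}" if "C \<in> snd \<tau>" for C using components_subset[OF \<tau>(1) that] .
  have "A \<noteq> {}" using component_family_half[OF \<tau>(1)] A by (auto simp: component_family_def)
  then have ne: "insert (Suc n) A \<noteq> {Suc n}" using sub[OF A] by auto
  note rep = replace_component[OF \<tau>(1) A, of "insert (Suc n) A" "Suc n"]
  have X: "{1..n} - A \<union> insert (Suc n) A = {1..Suc n}" "insert (Suc n) A \<inter> ({1..n} - A) = {}"
    using sub[OF A] by auto
  have "attach (Suc n) \<tau> A \<in> rooted_halves n l"
    using rep(1,2)[OF _ X(2,1)] \<tau>(2) by (simp add: attach_def marked_halves_Suc)
  moreover have "{Suc n} \<notin> snd (attach (Suc n) \<tau> A)"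
    using ne sub[of "{Suc n}"] by (auto simp: attach_def)
  ultimately show "(case a of (\<tau>, A) \<Rightarrow> attach (Suc n) \<tau> A) \<in> {\<sigma> \<in> rooted_halves n l. {Suc n} \<notin> snd \<sigma>}"
    unfolding a by simp
next
  fix \<sigma> assume "\<sigma> \<in> {\<sigma> \<in> rooted_halves n l. {Suc n} \<notin> snd \<sigma>}"
  then obtain B where \<sigma>: "\<sigma> \<in> half_partitions (Suc n)" "card (snd \<sigma>) = Suc l" "{Suc n} \<notin> snd \<sigma>"
    and B: "B \<in> snd \<sigma>" "Suc n \<in> B" by (auto simp: marked_halves_Suc)
  define A where "A = B - {Suc n}"
  define \<tau> where "\<tau> = (fst \<sigma>, insert A (snd \<sigma> - {B}))"
  have BA: "B = insert (Suc n) A" using B(2) by (auto simp: A_def)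
  have A: "A \<noteq> {}" using \<sigma>(3) B(1) BA by auto
  have X: "A \<inter> ({1..Suc n} - B) = {}" "{1..Suc n} - B \<union> A = {1..n}"
    using components_subset[OF \<sigma>(1) B(1)] B(2) by (auto simp: A_def le_Suc_eq)
  note rep = replace_component[OF \<sigma>(1) B(1) A X]
  have "(\<tau>, A) \<in> (SIGMA \<tau>:halves_of_rank n (Suc l). snd \<tau>)"
    using rep(1,2) \<sigma>(2) by (simp add: \<tau>_def)
  moreover have "attach (Suc n) \<tau> A = \<sigma>"
  proof -
    have "insert A (snd \<sigma> - {B}) - {A} = snd \<sigma> - {B}" using rep(3) by blast
    then show ?thesis using B(1) by (simp add: attach_def \<tau>_def insert_absorb flip: BA)
  qed
  ultimately show "\<exists>a\<in>SIGMA \<tau>:halves_of_rank n (Suc l). snd \<tau>. \<sigma> = (case a of (\<tau>, A) \<Rightarrow> attach (Suc n) \<tau> A)"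
    by (intro bexI[of _ "(\<tau>, A)"]) auto
qed

lemma bij_component_label:
  "bij_betw (\<lambda>(\<tau>, i). (\<tau>, inv_into (snd \<tau>) (component_position (snd \<tau>)) i))
     (halves_of_rank n l \<times> {1..l}) (SIGMA \<tau>:halves_of_rank n l. snd \<tau>)"
proof -
  have pos: "bij_betw (component_position (snd \<tau>)) (snd \<tau>) {1..l}" if "\<tau> \<in> halves_of_rank n l" for \<tau>
    using bij_component_position[OF component_family_subset[OF component_family_half, of \<tau> n "snd \<tau>"]] that
    by simp
  show ?thesis
  proof (rule bij_betw_byWitness[where f' = "\<lambda>(\<tau>, A). (\<tau>, component_position (snd \<tau>) A)"])
    show "\<forall>a\<in>halves_of_rank n l \<times> {1..l}. (case case a of (\<tau>, i) \<Rightarrow>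
        (\<tau>, inv_into (snd \<tau>) (component_position (snd \<tau>)) i) of (\<tau>, A) \<Rightarrow>
        (\<tau>, component_position (snd \<tau>) A)) = a"
      using bij_betw_inv_into_right[OF pos] by auto
    show "\<forall>a\<in>SIGMA \<tau>:halves_of_rank n l. snd \<tau>. (case case a of (\<tau>, A) \<Rightarrow>
        (\<tau>, component_position (snd \<tau>) A) of (\<tau>, i) \<Rightarrow>
        (\<tau>, inv_into (snd \<tau>) (component_position (snd \<tau>)) i)) = a"
      using bij_betw_inv_into_left[OF pos] by auto
    show "(\<lambda>(\<tau>, i). (\<tau>, inv_into (snd \<tau>) (component_position (snd \<tau>)) i)) ` (halves_of_rank n l \<times> {1..l})
        \<subseteq> (SIGMA \<tau>:halves_of_rank n l. snd \<tau>)"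
      using bij_betw_apply[OF bij_betw_inv_into[OF pos]] by auto
    show "(\<lambda>(\<tau>, A). (\<tau>, component_position (snd \<tau>) A)) ` (SIGMA \<tau>:halves_of_rank n l. snd \<tau>)
        \<subseteq> halves_of_rank n l \<times> {1..l}"
      using bij_betw_apply[OF pos] by auto
  qed
qed

text \<open>The edge that keeps the shape yields the half-partitions where \<open>n + 1\<close> is alone. On the edges that
  remove a box, \<open>branching_up\<close> turns the larger tableau into one of shape \<open>\<nu>\<close> and a number, and this
  number selects the component that \<open>n + 1\<close> joins.\<close>

lemma odd_step:
  assumes nu: "nu \<in> int_partitions"
  shows "\<exists>g. bij_betw g (SIGMA lam:insert nu (upper nu). Yp_even n lam) (Yp_odd n nu)"
proof -
  let ?l = "psize nu"
  have size: "psize lam = Suc ?l" if "lam \<in> upper nu" for lam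
    using that psize_grow[OF nu] by (auto simp: upper_def)
  have neq: "lam \<noteq> nu" if "lam \<in> upper nu" for lam using size[OF that] by auto
  let ?H = "halves_of_rank n (Suc ?l)"
  let ?D = "{\<sigma> \<in> rooted_halves n ?l. {Suc n} \<in> snd \<sigma>}" and ?E = "{\<sigma> \<in> rooted_halves n ?l. {Suc n} \<notin> snd \<sigma>}"
  obtain b where b: "bij_betw b (SIGMA lam:upper nu. standard_tableaux lam) ({1..Suc ?l} \<times> standard_tableaux nu)"
    using branching_up[OF nu refl] by blast
  obtain c where c: "bij_betw c (?H \<times> {1..Suc ?l}) ?E"
    using bij_betw_trans[OF bij_component_label bij_attach] by blast
  define g where "g = (\<lambda>(lam, \<tau>, T). if lam = nu then ((fst \<tau>, insert {Suc n} (snd \<tau>)), T)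
    else (c (\<tau>, fst (b (lam, T))), snd (b (lam, T))))"
  have 1: "bij_betw g (SIGMA lam:{nu}. Yp_even n lam) (?D \<times> standard_tableaux nu)"
  proof -
    have "bij_betw snd (SIGMA lam:{nu}. Yp_even n lam) (halves_of_rank n ?l \<times> standard_tableaux nu)"
      by (auto simp: bij_betw_def inj_on_def Yp_even_eq image_iff)
    from bij_betw_trans[OF this bij_betw_map_prod[OF bij_new_root bij_betw_id]] show ?thesis
      by (rule bij_betw_cong[THEN iffD1, rotated]) (auto simp: g_def)
  qed
  have 2: "bij_betw g (SIGMA lam:upper nu. Yp_even n lam) (?E \<times> standard_tableaux nu)"
  proof -
    have dom: "(SIGMA lam:upper nu. Yp_even n lam) = (SIGMA lam:upper nu. ?H \<times> standard_tableaux lam)"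
      by (rule Sigma_cong) (simp_all only: Yp_even_eq size)
    have assoc: "bij_betw (\<lambda>(\<tau>, i, S). ((\<tau>, i), S)) (?H \<times> ({1..Suc ?l} \<times> standard_tableaux nu))
        ((?H \<times> {1..Suc ?l}) \<times> standard_tableaux nu)"
      by (rule bij_betw_byWitness[where f' = "\<lambda>((\<tau>, i), S). (\<tau>, i, S)"]) auto
    have "bij_betw (map_prod c id \<circ> ((\<lambda>(\<tau>, i, S). ((\<tau>, i), S)) \<circ> (map_prod id b \<circ> (\<lambda>(lam, \<tau>, T). (\<tau>, lam, T)))))
        (SIGMA lam:upper nu. Yp_even n lam) (?E \<times> standard_tableaux nu)"
      unfolding dom
      by (rule bij_betw_trans[OF bij_betw_trans[OF bij_betw_trans[OF bij_betw_Sigma_swap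
        bij_betw_map_prod[OF bij_betw_id b]] assoc] bij_betw_map_prod[OF c bij_betw_id]])
    then show ?thesis
      by (rule bij_betw_cong[THEN iffD1, rotated]) (use neq in \<open>auto simp: g_def split: prod.splits\<close>)
  qed
  have "bij_betw g ((SIGMA lam:{nu}. Yp_even n lam) \<union> (SIGMA lam:upper nu. Yp_even n lam))
      (?D \<times> standard_tableaux nu \<union> ?E \<times> standard_tableaux nu)"
    by (rule bij_betw_combine[OF 1 2]) auto
  moreover have "(SIGMA lam:{nu}. Yp_even n lam) \<union> (SIGMA lam:upper nu. Yp_even n lam) =
      (SIGMA lam:insert nu (upper nu). Yp_even n lam)" by auto
  moreover have "?D \<times> standard_tableaux nu \<union> ?E \<times> standard_tableaux nu = Yp_odd n nu"
    unfolding Yp_odd_eq by blast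
  ultimately show ?thesis by metis
qed

lemma wf_double_young_graph: "wf_digraph double_young_graph"
  by unfold_locales (auto simp: double_young_graph_def)

lemma arcs_into_Inl:
  "lam \<in> int_partitions \<Longrightarrow> {e \<in> arcs double_young_graph. head double_young_graph e = Inl lam} =
     (\<lambda>nu. (Inr nu, Inl lam)) ` insert lam (lower lam)"
  by (auto simp: double_young_graph_def double_young_edge_iff lower_def)

lemma arcs_into_Inr:
  "nu \<in> int_partitions \<Longrightarrow> {e \<in> arcs double_young_graph. head double_young_graph e = Inr nu} =
     (\<lambda>lam. (Inl lam, Inr nu)) ` insert nu (upper nu)"
  by (auto simp: double_young_graph_def double_young_edge_iff upper_def)

lemma empty_partition: "empty_partition \<in> int_partitions" "psize empty_partition = 0"
  by (auto simp: empty_partition_def int_partitions_def psize_def antimono_def)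

lemma psize_eq_0_iff:
  assumes "lam \<in> int_partitions"
  shows "psize lam = 0 \<longleftrightarrow> lam = empty_partition"
proof -
  have "finite {i. lam i \<noteq> 0}" using assms by (simp add: int_partitions_def)
  then show ?thesis by (auto simp: psize_def empty_partition_def)
qed

lemma Yp_0_singleton: "Yp 0 (Inl empty_partition) = {((({}, {}), []))}"
proof -
  have "half_partitions 0 = {({}, {})}" by (auto simp: half_partitions_def partition_on_empty)
  moreover have "standard_tableaux empty_partition = {[]}"
    using tableau_entries_empty
    by (auto simp: standard_tableaux_iff empty_partition) (auto simp: empty_partition_def)
  ultimately show ?thesis by (auto simp: Yp_even_eq empty_partition)
qed

lemma Yp_0_empty:
  assumes "v \<in> verts double_young_graph" "v \<noteq> Inl empty_partition"
  shows "Yp 0 v = {}"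
proof (cases v)
  case (Inl lam)
  then have "psize lam \<noteq> 0" using assms psize_eq_0_iff by (auto simp: double_young_graph_def)
  moreover have "card (snd \<sigma>) = 0" if "\<sigma> \<in> half_partitions 0" for \<sigma>
    using that by (auto simp: half_partitions_def partition_on_empty)
  ultimately show ?thesis by (auto simp: Inl Yp_even_eq)
qed simp

lemma pascal_array_Yp: "pascal_array double_young_graph (Inl empty_partition) Yp"
proof (rule pascal_arrayI[OF wf_double_young_graph])
  show "Inl empty_partition \<in> verts double_young_graph"
    using empty_partition by (simp add: double_young_graph_def)
  show "is_singleton (Yp 0 (Inl empty_partition))" unfolding Yp_0_singleton by simp
  show "Yp 0 v = {}" if "v \<in> verts double_young_graph" "v \<noteq> Inl empty_partition" for v
    using Yp_0_empty that .
  have tail: "tail double_young_graph = fst" by (simp add: double_young_graph_def)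
  fix m v assume v: "v \<in> verts double_young_graph"
  let ?goal = "\<exists>g. bij_betw g (SIGMA e:{e \<in> arcs double_young_graph. head double_young_graph e = v}.
      Yp m (tail double_young_graph e)) (Yp (Suc m) v)"
  show ?goal
  proof (cases v)
    case (Inl lam)
    then have lam: "lam \<in> int_partitions" using v by (auto simp: double_young_graph_def)
    have "\<exists>g. bij_betw g (SIGMA nu:insert lam (lower lam). Yp m (fst (Inr nu :: vertex, Inl lam :: vertex))) (Yp (Suc m) v)"
    proof (cases "even m")
      case True
      then show ?thesis by (simp add: Inl bij_betw_def)
    next
      case False
      then obtain n where "m = Suc (2 * n)" by (metis oddE Suc_eq_plus1)
      then show ?thesis using even_step[OF lam, of n] by (simp add: Inl)
    qed
    then show ?thesis
      unfolding Inl arcs_into_Inl[OF lam] tail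
      by (intro exE[OF _ bij_betw_Sigma_reindex]) (auto simp: inj_on_def)
  next
    case (Inr nu)
    then have nu: "nu \<in> int_partitions" using v by (auto simp: double_young_graph_def)
    have "\<exists>g. bij_betw g (SIGMA lam:insert nu (upper nu). Yp m (fst (Inl lam :: vertex, Inr nu :: vertex))) (Yp (Suc m) v)"
    proof (cases "even m")
      case True
      then obtain n where "m = 2 * n" by (metis evenE)
      then show ?thesis using odd_step[OF nu, of n] by (simp add: Inr)
    next
      case False
      then show ?thesis by (simp add: Inr bij_betw_def)
    qed
    then show ?thesis
      unfolding Inr arcs_into_Inr[OF nu] tail
      by (intro exE[OF _ bij_betw_Sigma_reindex]) (auto simp: inj_on_def)
  qed
qed

theorem proposition7p4:
  shows "pascal_array double_young_graph (Inl empty_partition) Yp \<and>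
    (\<forall>n. inj_on (add_strand n) (Cp n) \<and> add_strand n ` Cp n \<subseteq> Cp_plus n \<and>
         Cp_plus n \<subseteq> Cp (n + 1) \<and>
         bij_betw bra_ket (Cp n)
           (SIGMA lam:int_partitions. Yp (2 * n) (Inl lam) \<times> Yp (2 * n) (Inl lam)) \<and>
         bij_betw (bra_ket_plus n) (Cp_plus n)
           (SIGMA lam:int_partitions. Yp (2 * n + 1) (Inr lam) \<times> Yp (2 * n + 1) (Inr lam)))"
  using pascal_array_Yp add_strand_Cp bij_bra_ket bij_bra_ket_plus by blast

end
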